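(* Let $\Omega\subset\mathbb{R}^n$ be a bounded domain and let $\mathcal{S}\subset\Omega$ satisfy the outward ball property. Let $$L[u]=\sum_{i,j=1}^n a_{ij}u_{x_ix_j}+\sum_{i=1}^n b_iu_{x_i}+cu\quad\text{in }\Omega\setminus\mathcal{S}$$ be a linear elliptic operator with coefficients $a_{ij},b_i,c:\Omega\setminus\mathcal{S}\to\mathbb{R}$ ($i,j=1,\dots,n$), and suppose that $u\in C^2(\Omega)\cap C^1(\bar\Omega)$ satisfies $L[u]\ge0$ on $\Omega\setminus\mathcal{S}$. Suppose that for each ball $B_R(x_0)\subset(\Omega\setminus\mathcal{S})$ (including balls with $\partial B_R(x_0)\cap\partial\Omega\neq\emptyset$) there exists a continuous non-increasing function $\Lambda:\left(0,\tfrac R2\right]\to(0,\infty)$ with $\Lambda\in L^1\left(\left(0,\tfrac R2\right]\right)$ such that, writing $d(x)=d(\{x\},\partial B_R(x_0))$, the following hold for all $x\in B_R(x_0)$ with $d(x)\le\tfrac R2$: $$|y|^2\le\sum_{i,j=1}^n a_{ij}(x)y_iy_j\le\Lambda(d(x))\,|y|^2\quad\forall y\in\mathbb{R}^n,$$ $$|b_i(x)|\le\Lambda(d(x))\quad\text{for } i=1,\dots,n,$$ $$c(x)\ge\frac{-\Lambda(d(x))}{d(x)} .$$ Let $M_u=\sup_{x\in\Omega}u(x)$ and suppose that either $M_u=0$, or $M_u>0$ with $c$ non-positive. Suppose in addition that $\sup_{x\in\Omega}u(x)=u(x_b)$ for some $x_b\in\partial\Omega$ such that there exists a ball $B_{R_b}(x_b')\subset\Omega\setminus\mathcal{S}$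 with $x_b\in\partial B_{R_b}(x_b')$. If $u$ is not constant on $\Omega$, then $\partial_\nu u(x_b)>0$.
   Context: A bounded domain is an open connected bounded set. $B_R(x_0)\subset\mathbb{R}^n$ is the open Euclidean ball of radius $R$ centred at $x_0$, and $d(\{x\},Y)=\inf_{y\in Y}|x-y|$ is the Euclidean distance from $x$ to $Y$. Outward ball property: a set $\mathcal{S}\subset\Omega$ satisfies an outward ball property if, given any nonempty relatively closed set $\mathcal{T}\subset\Omega$ that is a strict subset of $\Omega$, there exist $R>0$ and $x_0\in\Omega\setminus(\mathcal{T}\cup\mathcal{S})$ such that $B_R(x_0)\subset\Omega\setminus(\mathcal{T}\cup\mathcal{S})$ and $\partial B_R(x_0)\cap\mathcal{T}\ne\emptyset$. The operator $L$ is linear elliptic in the sense that there exists a non-negative function $\Lambda_0:\Omega\setminus\mathcal{S}\to\mathbb{R}$ with $|y|^2\le\sum_{i,j=1}^n a_{ij}(x)y_iy_j\le\Lambda_0(x)|y|^2$ for all $x\in\Omega\setminus\mathcal{S}$, $y\in\mathbb{R}^n$. The coefficients are arbitrary prescribed real-valued functions (no continuity is assumed) and need not be defined on $\mathcal{S}$. $\partial_\nu u(x_b)$ denotes the outward normal derivative at $x_b$, i.e. the directional derivative of $u$ at $x_b$ in the direction $\nu=(x_b-x_b')/R_b$. *)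

theory Defs
  imports "HOL-Analysis.Analysis"
begin

definition partial_deriv :: "'n::finite \<Rightarrow> (real^'n \<Rightarrow> real) \<Rightarrow> real^'n \<Rightarrow> real" where
  "partial_deriv i u x = frechet_derivative u (at x) (axis i 1)"

definition C1_on :: "(real^'n::finite) set \<Rightarrow> (real^'n \<Rightarrow> real) \<Rightarrow> bool" where
  "C1_on \<Omega> u \<longleftrightarrow>
     (\<forall>x\<in>\<Omega>. u differentiable (at x)) \<and> (\<forall>i. continuous_on \<Omega> (partial_deriv i u))"

definition C2_on :: "(real^'n::finite) set \<Rightarrow> (real^'n \<Rightarrow> real) \<Rightarrow> bool" where
  "C2_on \<Omega> u \<longleftrightarrow> C1_on \<Omega> u \<and> (\<forall>i. C1_on \<Omega> (partial_deriv i u))"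

text \<open>The space usually written \<open>C\<^sup>1\<close> of the closure of an open set \<open>\<Omega>\<close>: \<open>u\<close> is continuous up to the
  boundary and its first partial derivatives, taken in \<open>\<Omega>\<close>, extend continuously to the closure.
  The values of \<open>u\<close> outside the closure are irrelevant.\<close>

definition C1_closure :: "(real^'n::finite) set \<Rightarrow> (real^'n \<Rightarrow> real) \<Rightarrow> bool" where
  "C1_closure \<Omega> u \<longleftrightarrow>
     C1_on \<Omega> u \<and> continuous_on (closure \<Omega>) u \<and>
     (\<forall>i. \<exists>g. continuous_on (closure \<Omega>) g \<and> (\<forall>x\<in>\<Omega>. g x = partial_deriv i u x))"

definition outward_ball_property :: "(real^'n::finite) set \<Rightarrow> (real^'n) set \<Rightarrow> bool" where
  "outward_ball_property \<Omega> S \<longleftrightarrow>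
     (\<forall>T. T \<noteq> {} \<and> closedin (top_of_set \<Omega>) T \<and> T \<subset> \<Omega> \<longrightarrow>
        (\<exists>R>0. \<exists>x0 \<in> \<Omega> - (T \<union> S).
           ball x0 R \<subseteq> \<Omega> - (T \<union> S) \<and> sphere x0 R \<inter> T \<noteq> {}))"

text \<open>Coefficients are total functions in HOL; every hypothesis below only involves their values
  on \<open>\<Omega> - S\<close>.\<close>

definition quad_form :: "('n::finite \<Rightarrow> 'n \<Rightarrow> real^'n \<Rightarrow> real) \<Rightarrow> real^'n \<Rightarrow> real^'n \<Rightarrow> real" where
  "quad_form a x y = (\<Sum>i\<in>UNIV. \<Sum>j\<in>UNIV. a i j x * y $ i * y $ j)"

definition elliptic_on :: "(real^'n::finite) set \<Rightarrow> ('n \<Rightarrow> 'n \<Rightarrow> real^'n \<Rightarrow> real) \<Rightarrow> bool" where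
  "elliptic_on A a \<longleftrightarrow>
     (\<exists>\<Lambda>0 :: real^'n \<Rightarrow> real. \<forall>x\<in>A. 0 \<le> \<Lambda>0 x \<and>
        (\<forall>y. (norm y)\<^sup>2 \<le> quad_form a x y \<and> quad_form a x y \<le> \<Lambda>0 x * (norm y)\<^sup>2))"

definition diff_op ::
  "('n::finite \<Rightarrow> 'n \<Rightarrow> real^'n \<Rightarrow> real) \<Rightarrow> ('n \<Rightarrow> real^'n \<Rightarrow> real) \<Rightarrow> (real^'n \<Rightarrow> real) \<Rightarrow>
   (real^'n \<Rightarrow> real) \<Rightarrow> real^'n \<Rightarrow> real" where
  "diff_op a b c u x =
     (\<Sum>i\<in>UNIV. \<Sum>j\<in>UNIV. a i j x * partial_deriv j (partial_deriv i u) x)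
     + (\<Sum>i\<in>UNIV. b i x * partial_deriv i u x) + c x * u x"

text \<open>At a boundary point \<open>p\<close> the function \<open>u\<close> is only meaningful on the inner side of the direction
  \<open>\<nu>\<close>, so the outward directional derivative is the one-sided derivative of \<open>t \<mapsto> u (p + t \<nu>)\<close> at
  \<open>0\<close> from the left.\<close>

definition has_outward_derivative ::
  "(real^'n::finite \<Rightarrow> real) \<Rightarrow> real^'n \<Rightarrow> real^'n \<Rightarrow> real \<Rightarrow> bool" where
  "has_outward_derivative u p \<nu> D \<longleftrightarrow>
     ((\<lambda>t. u (p + t *\<^sub>R \<nu>)) has_real_derivative D) (at 0 within {..0})"

end

theory Submission imports Defs begin

text \<open>
  The proof combines a Hopf boundary point lemma with the outward ball property. Let \<open>M\<close> be the
  supremum of \<open>u\<close>. Suppose that \<open>u < M\<close> in a ball of radius \<open>R\<close> contained in \<open>\<Omega> - S\<close> and \<open>u p = M\<close> at a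
  point \<open>p\<close> of its sphere. In terms of the distance \<open>d\<close> to the sphere, the barrier \<open>\<phi> d\<close> with
  \<open>\<phi>'' = K \<Lambda> \<phi>'\<close>, \<open>\<phi> 0 = 0\<close>, \<open>\<phi>' 0 = 1\<close> is a strict subsolution in the outer half of the ball once \<open>K\<close> is
  large: the coefficients cost at most a constant multiple of \<open>\<Lambda> \<phi>'\<close>, where the lower bound
  \<open>- \<Lambda> d / d\<close> on \<open>c\<close> is admissible because convexity gives \<open>\<phi> d \<le> d \<phi>' d\<close>. The profile has a finite
  slope at \<open>0\<close> since \<open>\<Lambda>\<close> is integrable (\<open>barrier_profile\<close>).

  Comparing \<open>u\<close> with \<open>M - \<epsilon> \<phi> d\<close> on the annulus yields \<open>u \<le> M - \<epsilon> d\<close> there (\<open>hopf_linear_decay\<close>).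
  The comparison looks at an interior maximum of \<open>u + \<epsilon> \<phi> d\<close> with positive value, where the Hessian
  is negative semidefinite and its product with the elliptic coefficient matrix has nonpositive
  trace (\<open>elliptic_trace_nonpos\<close>, which needs the symmetry of second derivatives), contradicting
  strictness (\<open>no_positive_interior_max\<close>). Consequently the outward derivative at \<open>p\<close>, which exists
  because the gradient extends continuously to the closure, is at least \<open>\<epsilon>\<close>
  (\<open>hopf_boundary_point\<close>).

  If \<open>u\<close> attained \<open>M\<close> inside \<open>\<Omega>\<close> without being constant, the outward ball property would provide such
  a ball touching the set of maximum points at an interior point of \<open>\<Omega>\<close>, where the gradient vanishes:
  a contradiction. So \<open>u < M\<close> throughout \<open>\<Omega>\<close>, and the boundary point lemma applies at \<open>xb\<close>.
\<close>

section \<open>Products of definite matrices\<close>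

text \<open>
  The Frobenius product of a positive and a negative semidefinite symmetric matrix is nonpositive.
  One elimination step of the Cholesky algorithm splits \<open>A\<close> into a rank-one matrix built from its
  \<open>k\<close>-th column, whose product with \<open>H\<close> is a value of the quadratic form of \<open>H\<close>, and the Schur
  complement \<open>A'\<close>, which lives on one index fewer. Bounding the form of \<open>A\<close> below by the identity,
  and not only by zero, is what the induction carries: it makes every pivot at least \<open>1\<close>, and the
  Schur complement inherits it because its form is the minimum of that of \<open>A\<close> over the eliminated
  coordinate.
\<close>

lemma sum_products_nonpos:
  fixes A H :: "'i \<Rightarrow> 'i \<Rightarrow> real"
  assumes "finite I"
    and "\<And>i j. A i j = A j i"
    and "\<And>y. (\<Sum>i\<in>I. (y i)\<^sup>2) \<le> (\<Sum>i\<in>I. \<Sum>j\<in>I. A i j * y i * y j)"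
    and "\<And>y. (\<Sum>i\<in>I. \<Sum>j\<in>I. H i j * y i * y j) \<le> 0"
  shows "(\<Sum>i\<in>I. \<Sum>j\<in>I. A i j * H i j) \<le> 0"
  using assms
proof (induction I arbitrary: A rule: finite_induct)
  case empty
  then show ?case by simp
next
  case (insert k I)
  have expand: "(\<Sum>i\<in>insert k I. \<Sum>j\<in>insert k I. F i j)
      = F k k + (\<Sum>j\<in>I. F k j) + (\<Sum>i\<in>I. F i k) + (\<Sum>i\<in>I. \<Sum>j\<in>I. F i j)" for F :: "'i \<Rightarrow> 'i \<Rightarrow> real"
    using insert.hyps by (simp add: sum.distrib algebra_simps)
  have "1 \<le> A k k"
  proof -
    have "(\<Sum>i\<in>insert k I. (if i = k then 1 else 0 :: real)\<^sup>2) = 1"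
      using insert.hyps by (simp add: if_distrib[of "\<lambda>x. x\<^sup>2"] cong: if_cong)
    moreover have "(\<Sum>i\<in>insert k I. \<Sum>j\<in>insert k I. A i j * (if i = k then 1 else 0) * (if j = k then 1 else 0)) = A k k"
      using insert.hyps by (subst expand) (simp add: sum.neutral)
    ultimately show ?thesis
      using insert.prems(2)[of "\<lambda>i. if i = k then 1 else 0"] by simp
  qed
  then have akk: "A k k > 0" by simp
  have sym_k: "A i k = A k i" if "i \<in> I" for i
    by (rule insert.prems(1))
  define A' where "A' i j = A i j - A i k * A k j / A k k" for i j
  have sym': "A' i j = A' j i" for i j
    unfolding A'_def using insert.prems(1) by (metis mult.commute)
  have ell': "(\<Sum>i\<in>I. (y i)\<^sup>2) \<le> (\<Sum>i\<in>I. \<Sum>j\<in>I. A' i j * y i * y j)" for y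
  proof -
    \<comment> \<open>The value of the \<open>k\<close>-th coordinate that minimises the quadratic form, the others being fixed.\<close>
    define s where "s = (\<Sum>j\<in>I. A k j * y j)"
    define z where "z = y(k := - s / A k k)"
    have zI: "z i = y i" if "i \<in> I" for i
      using that insert.hyps unfolding z_def by auto
    have zk: "z k = - s / A k k" unfolding z_def by simp
    have "(\<Sum>i\<in>I. (y i)\<^sup>2) \<le> (\<Sum>i\<in>insert k I. (z i)\<^sup>2)"
      using insert.hyps by (simp add: zI)
    also have "\<dots> \<le> (\<Sum>i\<in>insert k I. \<Sum>j\<in>insert k I. A i j * z i * z j)"
      by (rule insert.prems(2))
    also have "\<dots> = A k k * z k * z k + (\<Sum>j\<in>I. A k j * z k * z j) + (\<Sum>i\<in>I. A i k * z i * z k)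
        + (\<Sum>i\<in>I. \<Sum>j\<in>I. A i j * z i * z j)"
      by (rule expand)
    also have "(\<Sum>j\<in>I. A k j * z k * z j) = z k * s"
      unfolding s_def sum_distrib_left by (rule sum.cong) (auto simp: zI)
    also have "(\<Sum>i\<in>I. A i k * z i * z k) = z k * s"
      unfolding s_def sum_distrib_left by (rule sum.cong) (auto simp: zI sym_k)
    also have "(\<Sum>i\<in>I. \<Sum>j\<in>I. A i j * z i * z j) = (\<Sum>i\<in>I. \<Sum>j\<in>I. A i j * y i * y j)"
      by (intro sum.cong refl) (auto simp: zI)
    also have "A k k * z k * z k + z k * s + z k * s + (\<Sum>i\<in>I. \<Sum>j\<in>I. A i j * y i * y j)
        = (\<Sum>i\<in>I. \<Sum>j\<in>I. A i j * y i * y j) - s * s / A k k"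
      using akk by (simp add: zk field_simps)
    also have "s * s / A k k = (\<Sum>i\<in>I. \<Sum>j\<in>I. A i k * A k j / A k k * y i * y j)"
      unfolding s_def sum_product sum_divide_distrib
      by (intro sum.cong refl) (auto simp: sym_k)
    also have "(\<Sum>i\<in>I. \<Sum>j\<in>I. A i j * y i * y j) - \<dots> = (\<Sum>i\<in>I. \<Sum>j\<in>I. A' i j * y i * y j)"
      unfolding A'_def by (simp add: sum_subtractf algebra_simps)
    finally show ?thesis .
  qed
  have Hneg: "(\<Sum>i\<in>I. \<Sum>j\<in>I. H i j * y i * y j) \<le> 0" for y
  proof -
    have zI: "(y(k := 0)) i = y i" if "i \<in> I" for i
      using that insert.hyps by auto
    have "(\<Sum>i\<in>I. \<Sum>j\<in>I. H i j * (y(k := 0)) i * (y(k := 0)) j) \<le> 0"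
      using insert.prems(3)[of "y(k := 0)"] by (subst (asm) expand) simp
    moreover have "(\<Sum>i\<in>I. \<Sum>j\<in>I. H i j * (y(k := 0)) i * (y(k := 0)) j) = (\<Sum>i\<in>I. \<Sum>j\<in>I. H i j * y i * y j)"
      by (intro sum.cong refl) (simp only: zI)
    ultimately show ?thesis by simp
  qed
  have IH: "(\<Sum>i\<in>I. \<Sum>j\<in>I. A' i j * H i j) \<le> 0"
    by (rule insert.IH[OF sym' ell' Hneg])
  have A'k: "A' k j = 0" "A' j k = 0" for j
    unfolding A'_def using akk by auto
  have split: "A i j = A' i j + A i k * A j k / A k k" for i j
    unfolding A'_def by (simp add: insert.prems(1)[of k j])
  have "(\<Sum>i\<in>insert k I. \<Sum>j\<in>insert k I. A i j * H i j)
     = (\<Sum>i\<in>insert k I. \<Sum>j\<in>insert k I. A' i j * H i j)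
     + (\<Sum>i\<in>insert k I. \<Sum>j\<in>insert k I. H i j * A i k * A j k) / A k k"
    unfolding sum_divide_distrib sum.distrib[symmetric]
    by (intro sum.cong refl) (subst split, simp add: algebra_simps)
  also have "(\<Sum>i\<in>insert k I. \<Sum>j\<in>insert k I. A' i j * H i j) = (\<Sum>i\<in>I. \<Sum>j\<in>I. A' i j * H i j)"
    by (subst expand) (simp add: A'k)
  also have "\<dots> + (\<Sum>i\<in>insert k I. \<Sum>j\<in>insert k I. H i j * A i k * A j k) / A k k \<le> 0"
    using IH insert.prems(3)[of "\<lambda>i. A i k"] akk by (intro add_nonpos_nonpos divide_nonpos_pos) auto
  finally show ?case .
qed

section \<open>Derivatives along lines and equality of mixed partials\<close>

lemma has_real_derivative_line:
  fixes u :: "real^'n::finite \<Rightarrow> real"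
  assumes "u differentiable (at (x + t *\<^sub>R y))"
  shows "((\<lambda>t. u (x + t *\<^sub>R y)) has_real_derivative
           (\<Sum>i\<in>UNIV. y $ i * partial_deriv i u (x + t *\<^sub>R y))) (at t)"
proof -
  let ?p = "x + t *\<^sub>R y"
  define D where "D = frechet_derivative u (at ?p)"
  have D: "(u has_derivative D) (at ?p)"
    unfolding D_def using assms frechet_derivative_works by blast
  have lin: "linear D" using D has_derivative_linear by blast
  have "((\<lambda>t. x + t *\<^sub>R y) has_derivative (\<lambda>s. s *\<^sub>R y)) (at t)"
    by (auto intro!: derivative_eq_intros)
  from has_derivative_compose[OF this D]
  have 1: "((\<lambda>t. u (x + t *\<^sub>R y)) has_derivative (\<lambda>s. D (s *\<^sub>R y))) (at t)" .
  have "D y = D (\<Sum>i\<in>UNIV. (y $ i) *\<^sub>R axis i 1)"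
    by (simp add: basis_expansion flip: scalar_mult_eq_scaleR)
  also have "\<dots> = (\<Sum>i\<in>UNIV. y $ i * partial_deriv i u ?p)"
    by (simp add: linear_sum[OF lin] linear_cmul[OF lin] partial_deriv_def flip: D_def)
  finally have "D (s *\<^sub>R y) = s * (\<Sum>i\<in>UNIV. y $ i * partial_deriv i u ?p)" for s
    by (simp add: linear_cmul[OF lin])
  with 1 show ?thesis
    by (simp add: has_field_derivative_def mult.commute[of _ "sum _ _"])
qed

lemma has_real_derivative_axis:
  fixes u :: "real^'n::finite \<Rightarrow> real"
  assumes "u differentiable (at (x + t *\<^sub>R axis i 1))"
  shows "((\<lambda>t. u (x + t *\<^sub>R axis i 1)) has_real_derivative partial_deriv i u (x + t *\<^sub>R axis i 1)) (at t)"
proof -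
  have "(\<Sum>k\<in>UNIV. axis i 1 $ k * partial_deriv k u (x + t *\<^sub>R axis i 1)) = partial_deriv i u (x + t *\<^sub>R axis i 1)"
    by (simp add: axis_def if_distrib[of "\<lambda>z. z * _"] cong: if_cong)
  with has_real_derivative_line[OF assms] show ?thesis by simp
qed

text \<open>
  Two applications of the mean value theorem, first in direction \<open>i\<close> and then in direction \<open>j\<close>, turn
  the second difference quotient into a value of the mixed partial derivative near \<open>x\<close>. The
  quotient is symmetric in the two directions, whence the equality of mixed partials.
\<close>

lemma second_difference_tendsto:
  fixes u :: "real^'n::finite \<Rightarrow> real"
  assumes "open \<Omega>" "C2_on \<Omega> u" "x \<in> \<Omega>"
  shows "((\<lambda>s. (u (x + s *\<^sub>R axis i 1 + s *\<^sub>R axis j 1) - u (x + s *\<^sub>R axis i 1)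
              - u (x + s *\<^sub>R axis j 1) + u x) / s\<^sup>2)
          \<longlongrightarrow> partial_deriv j (partial_deriv i u) x) (at_right 0)"
proof (rule tendstoI)
  fix e :: real assume "e > 0"
  let ?f = "partial_deriv j (partial_deriv i u)"
  let ?i = "axis i 1 :: real^'n" and ?j = "axis j 1 :: real^'n"
  have diff: "\<And>y. y \<in> \<Omega> \<Longrightarrow> u differentiable (at y)"
    and diff2: "\<And>y. y \<in> \<Omega> \<Longrightarrow> partial_deriv i u differentiable (at y)"
    and cont: "continuous_on \<Omega> ?f"
    using assms(2) unfolding C2_on_def C1_on_def by auto
  have "isCont ?f x" using cont assms continuous_on_eq_continuous_at by blast
  then obtain d1 where d1: "d1 > 0" "\<And>y. dist y x < d1 \<Longrightarrow> dist (?f y) (?f x) < e"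
    using \<open>e > 0\<close> unfolding continuous_at_eps_delta by (metis dist_commute)
  obtain d2 where d2: "d2 > 0" "ball x d2 \<subseteq> \<Omega>"
    using assms openE by blast
  define d where "d = min d1 d2 / 2"
  have "d > 0" using d1 d2 unfolding d_def by simp
  have close: "dist (x + s *\<^sub>R ?i + t *\<^sub>R ?j) x < min d1 d2" if "0 \<le> s" "s < d" "0 \<le> t" "t < d" for s t
  proof -
    have "dist (x + s *\<^sub>R ?i + t *\<^sub>R ?j) x = norm (s *\<^sub>R ?i + t *\<^sub>R ?j)"
      by (simp add: dist_norm algebra_simps)
    also have "\<dots> \<le> s + t" using that norm_triangle_ineq[of "s *\<^sub>R ?i" "t *\<^sub>R ?j"] by simp
    also have "\<dots> < min d1 d2" using that unfolding d_def by simp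
    finally show ?thesis .
  qed
  have inO: "x + s *\<^sub>R ?i + t *\<^sub>R ?j \<in> \<Omega>" if "0 \<le> s" "s < d" "0 \<le> t" "t < d" for s t
    using close[OF that] d2 by (auto simp: dist_commute)
  have "dist ((u (x + s *\<^sub>R ?i + s *\<^sub>R ?j) - u (x + s *\<^sub>R ?i) - u (x + s *\<^sub>R ?j) + u x) / s\<^sup>2) (?f x) < e"
    if s: "0 < s" "s < d" for s
  proof -
    define g where "g = (\<lambda>t. u (x + s *\<^sub>R ?j + t *\<^sub>R ?i) - u (x + t *\<^sub>R ?i))"
    have "\<exists>z>0. z < s \<and> g s - g 0 = (s - 0) * (partial_deriv i u (x + s *\<^sub>R ?j + z *\<^sub>R ?i) - partial_deriv i u (x + z *\<^sub>R ?i))"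
    proof (rule MVT2)
      fix t assume t: "0 \<le> t" "t \<le> s"
      have "u differentiable (at (x + s *\<^sub>R ?j + t *\<^sub>R ?i))" "u differentiable (at (x + t *\<^sub>R ?i))"
        using inO[of t s] inO[of t 0] t s diff by (auto simp: algebra_simps)
      then show "(g has_real_derivative (partial_deriv i u (x + s *\<^sub>R ?j + t *\<^sub>R ?i) - partial_deriv i u (x + t *\<^sub>R ?i))) (at t)"
        unfolding g_def by (intro DERIV_diff has_real_derivative_axis)
    qed (use s in auto)
    then obtain z where z: "0 < z" "z < s"
      "g s - g 0 = s * (partial_deriv i u (x + s *\<^sub>R ?j + z *\<^sub>R ?i) - partial_deriv i u (x + z *\<^sub>R ?i))" by auto
    have "\<exists>y>0. y < s \<and> partial_deriv i u (x + z *\<^sub>R ?i + s *\<^sub>R ?j) - partial_deriv i u (x + z *\<^sub>R ?i + 0 *\<^sub>R ?j)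
        = (s - 0) * ?f (x + z *\<^sub>R ?i + y *\<^sub>R ?j)"
    proof (rule MVT2)
      fix t assume t: "0 \<le> t" "t \<le> s"
      show "((\<lambda>t. partial_deriv i u (x + z *\<^sub>R ?i + t *\<^sub>R ?j)) has_real_derivative ?f (x + z *\<^sub>R ?i + t *\<^sub>R ?j)) (at t)"
        using inO[of z t] t s z by (intro has_real_derivative_axis diff2) auto
    qed (use s in auto)
    then obtain y where y: "0 < y" "y < s"
      "partial_deriv i u (x + z *\<^sub>R ?i + s *\<^sub>R ?j) - partial_deriv i u (x + z *\<^sub>R ?i) = s * ?f (x + z *\<^sub>R ?i + y *\<^sub>R ?j)"
      by auto
    have "u (x + s *\<^sub>R ?i + s *\<^sub>R ?j) - u (x + s *\<^sub>R ?i) - u (x + s *\<^sub>R ?j) + u x = g s - g 0"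
      unfolding g_def by (simp add: algebra_simps)
    also have "\<dots> = s * (partial_deriv i u (x + z *\<^sub>R ?i + s *\<^sub>R ?j) - partial_deriv i u (x + z *\<^sub>R ?i))"
      unfolding z(3) by (simp add: algebra_simps)
    also have "\<dots> = s\<^sup>2 * ?f (x + z *\<^sub>R ?i + y *\<^sub>R ?j)"
      unfolding y(3) by (simp add: power2_eq_square)
    finally have "(u (x + s *\<^sub>R ?i + s *\<^sub>R ?j) - u (x + s *\<^sub>R ?i) - u (x + s *\<^sub>R ?j) + u x) / s\<^sup>2 = ?f (x + z *\<^sub>R ?i + y *\<^sub>R ?j)"
      using s by simp
    then show ?thesis using d1(2)[of "x + z *\<^sub>R ?i + y *\<^sub>R ?j"] close[of z y] y z s by simp
  qed
  then show "\<forall>\<^sub>F s in at_right 0. dist ((u (x + s *\<^sub>R ?i + s *\<^sub>R ?j) - u (x + s *\<^sub>R ?i) - u (x + s *\<^sub>R ?j) + u x) / s\<^sup>2) (?f x) < e"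
    using \<open>d > 0\<close> unfolding eventually_at_right_field by blast
qed

lemma mixed_partials_commute:
  fixes u :: "real^'n::finite \<Rightarrow> real"
  assumes "open \<Omega>" "C2_on \<Omega> u" "x \<in> \<Omega>"
  shows "partial_deriv j (partial_deriv i u) x = partial_deriv i (partial_deriv j u) x"
proof (rule tendsto_unique)
  show "((\<lambda>s. (u (x + s *\<^sub>R axis i 1 + s *\<^sub>R axis j 1) - u (x + s *\<^sub>R axis i 1)
              - u (x + s *\<^sub>R axis j 1) + u x) / s\<^sup>2)
          \<longlongrightarrow> partial_deriv j (partial_deriv i u) x) (at_right 0)"
    by (rule second_difference_tendsto[OF assms])
  show "((\<lambda>s. (u (x + s *\<^sub>R axis i 1 + s *\<^sub>R axis j 1) - u (x + s *\<^sub>R axis i 1)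
              - u (x + s *\<^sub>R axis j 1) + u x) / s\<^sup>2)
          \<longlongrightarrow> partial_deriv i (partial_deriv j u) x) (at_right 0)"
    using second_difference_tendsto[OF assms, of j i] by (simp add: algebra_simps)
qed simp

text \<open>
  A positive second derivative would make \<open>h'\<close> positive just to the right of \<open>0\<close>, so that \<open>h\<close> would
  increase there.
\<close>

lemma second_derivative_nonpos_at_local_max:
  fixes h h' :: "real \<Rightarrow> real"
  assumes "\<delta> > 0" and h: "\<And>t. \<bar>t\<bar> < \<delta> \<Longrightarrow> (h has_real_derivative h' t) (at t)"
    and h': "(h' has_real_derivative l) (at 0)"
    and le: "\<And>t. \<bar>t\<bar> < \<delta> \<Longrightarrow> h t \<le> h 0"
  shows "h' 0 = 0" "l \<le> 0"
proof -
  show h0: "h' 0 = 0"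
    using DERIV_local_max[OF h[of 0] \<open>\<delta> > 0\<close>] le \<open>\<delta> > 0\<close> by simp
  show "l \<le> 0"
  proof (rule ccontr)
    assume "\<not> l \<le> 0"
    then obtain d where d: "d > 0" "\<And>t. 0 < t \<Longrightarrow> t < d \<Longrightarrow> h' 0 < h' t"
      using DERIV_pos_inc_right[OF h'] by (auto simp: algebra_simps)
    define t where "t = min d \<delta> / 2"
    have t: "0 < t" "t < d" "t < \<delta>" using d \<open>\<delta> > 0\<close> unfolding t_def by auto
    have "\<exists>z>0. z < t \<and> h t - h 0 = (t - 0) * h' z"
      using t by (intro MVT2 h) auto
    then obtain z where z: "0 < z" "z < t" "h t - h 0 = t * h' z" by auto
    then have "h t > h 0" using d(2)[of z] h0 t by (metis diff_gt_0_iff_gt mult_pos_pos order_less_trans)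
    then show False using le[of t] t by simp
  qed
qed

section \<open>Barrier profile and radial functions\<close>

text \<open>
  The profile solves \<open>\<phi>'' = K \<Lambda> \<phi>'\<close> with \<open>\<phi> 0 = 0\<close> and \<open>\<phi>' 0 = 1\<close>, so \<open>\<phi>'\<close> is the exponential of
  \<open>K\<close> times the primitive of \<open>\<Lambda>\<close>. Integrability of \<open>\<Lambda>\<close> at \<open>0\<close> keeps \<open>\<phi>'\<close> finite there, although
  \<open>\<phi>''\<close> may blow up. Convexity gives both bounds on \<open>\<phi>\<close>: the lower one makes the barrier grow at
  least linearly, the upper one absorbs the singular bound \<open>\<Lambda> t / t\<close> on the zeroth-order coefficient.
\<close>

lemma barrier_profile:
  fixes \<Lambda> :: "real \<Rightarrow> real"
  assumes \<rho>: "\<rho> > 0" and K: "K \<ge> 0"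
    and cont: "continuous_on {0<..\<rho>} \<Lambda>"
    and pos: "\<And>t. t \<in> {0<..\<rho>} \<Longrightarrow> \<Lambda> t > 0"
    and int: "\<Lambda> integrable_on {0<..\<rho>}"
  obtains \<phi> \<phi>' where
    "continuous_on {0..\<rho>} \<phi>" "\<phi> 0 = 0"
    "\<And>t. t \<in> {0<..<\<rho>} \<Longrightarrow> (\<phi> has_real_derivative \<phi>' t) (at t)"
    "\<And>t. t \<in> {0<..<\<rho>} \<Longrightarrow> (\<phi>' has_real_derivative K * \<Lambda> t * \<phi>' t) (at t)"
    "\<And>t. t \<in> {0..\<rho>} \<Longrightarrow> t \<le> \<phi> t"
    "\<And>t. t \<in> {0..\<rho>} \<Longrightarrow> \<phi> t \<le> t * \<phi>' t"
    "\<And>t. t \<in> {0..\<rho>} \<Longrightarrow> 1 \<le> \<phi>' t"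
proof -
  \<comment> \<open>The value of \<open>\<Lambda>\<close> at \<open>0\<close> is unknown; setting it to \<open>0\<close> allows integration over closed intervals.\<close>
  define F where "F t = (if t \<in> {0<..\<rho>} then \<Lambda> t else 0)" for t
  have F_int: "F integrable_on {0..\<rho>}"
  proof (rule integrable_on_superset)
    show "F integrable_on {0<..\<rho>}"
      by (rule integrable_eq[OF int]) (simp add: F_def)
  qed (auto simp: F_def)
  have F_int_sub: "F integrable_on {0..t}" if "t \<le> \<rho>" for t
    by (rule integrable_subinterval_real[OF F_int]) (use that in auto)
  have F_nonneg: "F t \<ge> 0" for t using pos[of t] by (auto simp: F_def)
  define G where "G t = integral {0..t} F" for t
  have G_mono: "G s \<le> G t" if "s \<le> t" "t \<le> \<rho>" for s t
    unfolding G_def using that F_int_sub F_nonneg by (intro integral_subset_le) auto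
  have G_nonneg: "0 \<le> G t" if "t \<le> \<rho>" for t
    unfolding G_def using that F_int_sub F_nonneg by (intro integral_nonneg) auto
  have G_cont: "continuous_on {0..\<rho>} G"
    unfolding G_def by (rule indefinite_integral_continuous_1[OF F_int])
  have G_deriv: "(G has_real_derivative \<Lambda> t) (at t)" if t: "t \<in> {0<..<\<rho>}" for t
  proof -
    have "continuous_on {0<..<\<rho>} F"
      using continuous_on_subset[OF cont, of "{0<..<\<rho>}"]
      by (rule continuous_on_eq) (auto simp: F_def)
    then have "isCont F t" using t continuous_on_eq_continuous_at open_greaterThanLessThan by blast
    then have "continuous (at t within ({0..\<rho>} - {})) F" by (rule continuous_at_imp_continuous_at_within)
    then have "(G has_vector_derivative F t) (at t within ({0..\<rho>} - {}))"
      unfolding G_def using t by (intro integral_has_vector_derivative_continuous_at[OF F_int]) auto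
    then have "(G has_real_derivative F t) (at t within {0..\<rho>})"
      by (simp add: has_real_derivative_iff_has_vector_derivative)
    moreover have "at t within {0..\<rho>} = at t"
      using t by (intro at_within_interior) simp
    ultimately show ?thesis using t by (simp add: F_def)
  qed
  define \<phi>' where "\<phi>' t = exp (K * G t)" for t
  define \<phi> where "\<phi> t = integral {0..t} \<phi>'" for t
  have \<phi>'_cont: "continuous_on {0..\<rho>} \<phi>'"
    unfolding \<phi>'_def by (intro continuous_intros G_cont)
  have \<phi>'_int: "\<phi>' integrable_on {0..t}" if "t \<le> \<rho>" for t
    using that by (intro integrable_continuous_interval continuous_on_subset[OF \<phi>'_cont]) auto
  have \<phi>'_ge: "1 \<le> \<phi>' t" if "t \<in> {0..\<rho>}" for t
    unfolding \<phi>'_def using K G_nonneg that by simp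
  have \<phi>_deriv: "(\<phi> has_real_derivative \<phi>' t) (at t)" if t: "t \<in> {0<..<\<rho>}" for t
  proof -
    have "(\<phi> has_real_derivative \<phi>' t) (at t within {0..\<rho>})"
      unfolding \<phi>_def using t by (intro integral_has_real_derivative[OF \<phi>'_cont]) auto
    moreover have "at t within {0..\<rho>} = at t"
      using t by (intro at_within_interior) simp
    ultimately show ?thesis by simp
  qed
  have \<phi>'_deriv: "(\<phi>' has_real_derivative K * \<Lambda> t * \<phi>' t) (at t)" if t: "t \<in> {0<..<\<rho>}" for t
    unfolding \<phi>'_def using G_deriv[OF t] by (auto intro!: derivative_eq_intros)
  have ge: "t \<le> \<phi> t" if t: "t \<in> {0..\<rho>}" for t
  proof -
    have "integral {0..t} (\<lambda>s. 1) \<le> integral {0..t} \<phi>'"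
      using t \<phi>'_ge \<phi>'_int by (intro integral_le) auto
    then show ?thesis unfolding \<phi>_def using t by simp
  qed
  have le: "\<phi> t \<le> t * \<phi>' t" if t: "t \<in> {0..\<rho>}" for t
  proof -
    have "integral {0..t} \<phi>' \<le> integral {0..t} (\<lambda>s. \<phi>' t)"
      using t \<phi>'_int G_mono K by (intro integral_le) (auto simp: \<phi>'_def intro!: mult_left_mono)
    then show ?thesis unfolding \<phi>_def using t by simp
  qed
  show thesis
  proof (rule that)
    show "continuous_on {0..\<rho>} \<phi>"
      unfolding \<phi>_def by (rule indefinite_integral_continuous_1) (use \<phi>'_int in auto)
    show "\<phi> 0 = 0" unfolding \<phi>_def by simp
  qed (use \<phi>_deriv \<phi>'_deriv ge le \<phi>'_ge in auto)
qed

lemma infdist_sphere: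
  fixes x x0 :: "'a::real_normed_vector"
  assumes "x \<noteq> x0" "dist x0 x \<le> R"
  shows "infdist x (sphere x0 R) = R - dist x0 x"
proof (rule antisym)
  let ?r = "norm (x - x0)"
  let ?y = "x0 + (R / ?r) *\<^sub>R (x - x0)"
  have r: "?r > 0" "?r \<le> R" using assms by (auto simp: dist_norm norm_minus_commute)
  then have "R > 0" by linarith
  have y: "?y \<in> sphere x0 R" using r \<open>R > 0\<close> by (simp add: dist_norm)
  have "x - ?y = (1 - R / ?r) *\<^sub>R (x - x0)" by (simp add: algebra_simps)
  then have "dist x ?y = \<bar>1 - R / ?r\<bar> * ?r" by (simp add: dist_norm)
  also have "\<dots> = R - ?r" using r by (simp add: abs_if field_simps)
  finally show "infdist x (sphere x0 R) \<le> R - dist x0 x"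
    using infdist_le[OF y, of x] by (simp add: dist_norm norm_minus_commute)
  have "R - dist x0 x \<le> dist x z" if "z \<in> sphere x0 R" for z
    using that dist_triangle[of x0 z x] by simp
  then show "R - dist x0 x \<le> infdist x (sphere x0 R)"
    using y unfolding infdist_def by (auto intro!: cINF_greatest)
qed

lemma radial_derivatives:
  fixes z y :: "'a::real_inner"
  assumes "z + t *\<^sub>R y \<noteq> 0"
  shows "((\<lambda>t. norm (z + t *\<^sub>R y)) has_real_derivative ((z + t *\<^sub>R y) \<bullet> y) / norm (z + t *\<^sub>R y)) (at t)"
    "((\<lambda>t. ((z + t *\<^sub>R y) \<bullet> y) / norm (z + t *\<^sub>R y)) has_real_derivative
       ((norm y)\<^sup>2 / norm (z + t *\<^sub>R y) - ((z + t *\<^sub>R y) \<bullet> y)\<^sup>2 / norm (z + t *\<^sub>R y) ^ 3)) (at t)"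
proof -
  let ?p = "z + t *\<^sub>R y"
  have line: "((\<lambda>t. z + t *\<^sub>R y) has_derivative (\<lambda>s. s *\<^sub>R y)) (at t)"
    by (auto intro!: derivative_eq_intros)
  show n: "((\<lambda>t. norm (z + t *\<^sub>R y)) has_real_derivative (?p \<bullet> y) / norm ?p) (at t)"
  proof -
    have "(\<lambda>s. (s *\<^sub>R y) \<bullet> sgn ?p) = (*) ((y \<bullet> ?p) / norm ?p)"
      by (rule ext) (simp add: sgn_div_norm divide_inverse del: inner_add_right)
    with has_derivative_compose[OF line has_derivative_norm[OF assms]] show ?thesis
      unfolding has_field_derivative_def by (metis inner_commute)
  qed
  have i: "((\<lambda>t. (z + t *\<^sub>R y) \<bullet> y) has_real_derivative (norm y)\<^sup>2) (at t)"
  proof -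
    have "(\<lambda>s. (s *\<^sub>R y) \<bullet> y) = (*) ((norm y)\<^sup>2)"
      by (rule ext) (simp add: power2_norm_eq_inner)
    with has_derivative_inner_left[OF line, of y] show ?thesis
      unfolding has_field_derivative_def by simp
  qed
  have pos: "norm ?p > 0" using assms by simp
  show "((\<lambda>t. ((z + t *\<^sub>R y) \<bullet> y) / norm (z + t *\<^sub>R y)) has_real_derivative
       ((norm y)\<^sup>2 / norm ?p - (?p \<bullet> y)\<^sup>2 / norm ?p ^ 3)) (at t)"
  proof -
    have "(n2 * r - q * (q / r)) / (r * r) = n2 / r - q\<^sup>2 / r ^ 3" if "r > 0" for n2 q r :: real
      using that by (simp add: field_simps power2_eq_square power3_eq_cube)
    from this[OF pos] DERIV_divide[OF i n] pos show ?thesis by simp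
  qed
qed

section \<open>One-sided derivatives\<close>

text \<open>
  A limit of the derivatives at interior points is the one-sided derivative at the end point, by the
  mean value theorem. This produces the normal derivative from the continuous extension of the
  gradient to the closure.
\<close>

lemma one_sided_derivative_from_limit:
  fixes h h' :: "real \<Rightarrow> real"
  assumes "\<delta> > 0" and cont: "continuous_on {-\<delta>..0} h"
    and deriv: "\<And>t. t \<in> {-\<delta><..<0} \<Longrightarrow> (h has_real_derivative h' t) (at t)"
    and lim: "(h' \<longlongrightarrow> D) (at_left 0)"
  shows "(h has_real_derivative D) (at 0 within {..0})"
proof -
  have "((\<lambda>t. (h t - h 0) / (t - 0)) \<longlongrightarrow> D) (at 0 within {..0})"
  proof (rule tendstoI)
    fix e :: real assume "e > 0"
    from tendstoD[OF lim this] obtain b where b: "b < 0" "\<And>t. b < t \<Longrightarrow> t < 0 \<Longrightarrow> dist (h' t) D < e"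
      unfolding eventually_at_left_field by blast
    define d where "d = min \<delta> (- b)"
    have "dist ((h t - h 0) / (t - 0)) D < e" if t: "t < 0" "- d < t" for t
    proof -
      have "\<exists>l z. t < z \<and> z < 0 \<and> (h has_real_derivative l) (at z) \<and> h 0 - h t = (0 - t) * l"
      proof (rule MVT)
        show "continuous_on {t..0} h"
          using t by (intro continuous_on_subset[OF cont]) (auto simp: d_def)
        fix z assume "t < z" "z < 0"
        then show "h differentiable (at z)"
          using t deriv[of z] unfolding real_differentiable_def by (intro exI[of _ "h' z"]) (auto simp: d_def)
      qed (use t in auto)
      then obtain l z where z: "t < z" "z < 0" "(h has_real_derivative l) (at z)" "h 0 - h t = (0 - t) * l"
        by blast
      have "l = h' z" using z t deriv[of z] by (intro DERIV_unique[OF z(3)]) (auto simp: d_def)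
      moreover have "(h t - h 0) / (t - 0) = l" using z(4) t by (simp add: field_simps)
      ultimately show ?thesis using b(2)[of z] z t by (simp add: d_def)
    qed
    moreover have "d > 0" using b \<open>\<delta> > 0\<close> by (simp add: d_def)
    ultimately show "\<forall>\<^sub>F t in at 0 within {..0}. dist ((h t - h 0) / (t - 0)) D < e"
      unfolding eventually_at by (intro exI[of _ d]) (auto simp: dist_real_def)
  qed
  then show ?thesis by (simp add: has_field_derivative_iff)
qed

lemma outward_derivative_ge:
  assumes D: "has_outward_derivative u p \<nu> D" and "\<delta> > 0"
    and le: "\<And>t. 0 < t \<Longrightarrow> t < \<delta> \<Longrightarrow> u (p - t *\<^sub>R \<nu>) \<le> u p - \<epsilon> * t"
  shows "\<epsilon> \<le> D"
proof (rule tendsto_lowerbound)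
  show "((\<lambda>t. (u (p + t *\<^sub>R \<nu>) - u (p + 0 *\<^sub>R \<nu>)) / (t - 0)) \<longlongrightarrow> D) (at_left 0)"
    using D unfolding has_outward_derivative_def has_field_derivative_iff
    by (rule tendsto_mono[OF at_le, rotated]) auto
  have "\<epsilon> \<le> (u (p + t *\<^sub>R \<nu>) - u (p + 0 *\<^sub>R \<nu>)) / (t - 0)" if "- \<delta> < t" "t < 0" for t
    using le[of "- t"] that by (simp add: field_simps)
  then show "\<forall>\<^sub>F t in at_left 0. \<epsilon> \<le> (u (p + t *\<^sub>R \<nu>) - u (p + 0 *\<^sub>R \<nu>)) / (t - 0)"
    unfolding eventually_at_left_field using \<open>\<delta> > 0\<close> by (intro exI[of _ "- \<delta>"]) auto
qed simp

section \<open>The maximum principle on an annulus\<close>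

text \<open>
  The ellipticity condition sees only the symmetric part of the coefficient matrix; since \<open>H\<close> is
  symmetric, the antisymmetric part does not contribute to the trace either.
\<close>

lemma elliptic_trace_nonpos:
  fixes a :: "'n::finite \<Rightarrow> 'n \<Rightarrow> real^'n \<Rightarrow> real"
  assumes ell: "\<And>y. (norm y)\<^sup>2 \<le> quad_form a x y"
    and sym: "\<And>i j. H i j = H j i"
    and neg: "\<And>y::real^'n. (\<Sum>i\<in>UNIV. \<Sum>j\<in>UNIV. H i j * y $ i * y $ j) \<le> 0"
  shows "(\<Sum>i\<in>UNIV. \<Sum>j\<in>UNIV. a i j x * H i j) \<le> 0"
proof -
  define A where "A i j = (a i j x + a j i x) / 2" for i j
  have half: "(\<Sum>i\<in>UNIV. \<Sum>j\<in>UNIV. A i j * F i j) = (\<Sum>i\<in>UNIV. \<Sum>j\<in>UNIV. a i j x * F i j)"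
    if "\<And>i j. F i j = F j i" for F
  proof -
    have "(\<Sum>i\<in>UNIV. \<Sum>j\<in>UNIV. a j i x * F i j) = (\<Sum>j\<in>UNIV. \<Sum>i\<in>UNIV. a j i x * F i j)"
      by (rule sum.swap)
    also have "\<dots> = (\<Sum>j\<in>UNIV. \<Sum>i\<in>UNIV. a j i x * F j i)"
      by (intro sum.cong refl) (subst that, rule refl)
    finally show ?thesis
      unfolding A_def by (simp add: add_divide_distrib distrib_right sum.distrib flip: sum_divide_distrib)
  qed
  have "(\<Sum>i\<in>UNIV. \<Sum>j\<in>UNIV. A i j * H i j) \<le> 0"
  proof (rule sum_products_nonpos)
    show "A i j = A j i" for i j by (simp add: A_def)
    show "(\<Sum>i\<in>UNIV. (y i)\<^sup>2) \<le> (\<Sum>i\<in>UNIV. \<Sum>j\<in>UNIV. A i j * y i * y j)" for y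
    proof -
      have "(\<Sum>i\<in>UNIV. (y i)\<^sup>2) = (norm (\<chi> i. y i))\<^sup>2"
        by (simp only: power2_norm_eq_inner) (simp add: inner_vec_def power2_eq_square)
      also have "\<dots> \<le> quad_form a x (\<chi> i. y i)" by (rule ell)
      also have "\<dots> = (\<Sum>i\<in>UNIV. \<Sum>j\<in>UNIV. a i j x * (y i * y j))"
        by (simp add: quad_form_def mult.assoc)
      also have "\<dots> = (\<Sum>i\<in>UNIV. \<Sum>j\<in>UNIV. A i j * (y i * y j))"
        by (rule half[symmetric]) (rule mult.commute)
      finally show ?thesis by (simp add: mult.assoc)
    qed
    show "(\<Sum>i\<in>UNIV. \<Sum>j\<in>UNIV. H i j * y i * y j) \<le> 0" for y
      using neg[of "\<chi> i. y i"] by simp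
  qed (use sym in auto)
  then show ?thesis by (simp add: half sym)
qed

text \<open>
  First and second order conditions at a local maximum of \<open>u\<close> plus a radial function, read off from
  restrictions to lines through \<open>x\<close>. Working along lines uses only one-variable derivatives of the
  radial part.
\<close>

lemma radial_perturbation_at_max:
  fixes u :: "real^'n::finite \<Rightarrow> real" and x x0 :: "real^'n"
  defines "r \<equiv> norm (x - x0)"
  assumes "open \<Omega>" and C2: "C2_on \<Omega> u"
    and e: "e > 0" "ball x e \<subseteq> \<Omega>" "\<And>y. y \<in> ball x e \<Longrightarrow> \<rho> < norm (y - x0) \<and> norm (y - x0) < R"
    and \<rho>: "0 \<le> \<rho>"
    and \<phi>: "\<And>t. t \<in> {0<..<R-\<rho>} \<Longrightarrow> (\<phi> has_real_derivative \<phi>' t) (at t)"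
    and \<phi>': "\<And>t. t \<in> {0<..<R-\<rho>} \<Longrightarrow> (\<phi>' has_real_derivative \<phi>'' t) (at t)"
    and max: "\<And>y. y \<in> ball x e \<Longrightarrow> u y + \<epsilon> * \<phi> (R - norm (y - x0)) \<le> u x + \<epsilon> * \<phi> (R - r)"
  shows "partial_deriv i u x = \<epsilon> * \<phi>' (R - r) * (x - x0) $ i / r"
    and "(\<Sum>i\<in>UNIV. \<Sum>j\<in>UNIV. partial_deriv j (partial_deriv i u) x * y $ i * y $ j)
       + \<epsilon> * ((\<phi>'' (R - r) / r\<^sup>2 + \<phi>' (R - r) / r ^ 3) * ((x - x0) \<bullet> y)\<^sup>2 - \<phi>' (R - r) / r * (norm y)\<^sup>2) \<le> 0"
proof -
  define z where "z = x - x0"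
  have diff: "\<And>y. y \<in> \<Omega> \<Longrightarrow> u differentiable (at y)"
    and diff2: "\<And>i y. y \<in> \<Omega> \<Longrightarrow> partial_deriv i u differentiable (at y)"
    using C2 unfolding C2_on_def C1_on_def by auto
  have x: "x \<in> ball x e" using e by simp
  have r: "\<rho> < r" "r < R" using e(3)[OF x] by (auto simp: r_def)
  have rpos: "r > 0" using r \<rho> by simp
  have line_max: "(\<Sum>i\<in>UNIV. y $ i * partial_deriv i u x) = \<epsilon> * \<phi>' (R - r) * (z \<bullet> y) / r
    \<and> (\<Sum>i\<in>UNIV. \<Sum>j\<in>UNIV. partial_deriv j (partial_deriv i u) x * y $ i * y $ j)
       + \<epsilon> * ((\<phi>'' (R - r) / r\<^sup>2 + \<phi>' (R - r) / r ^ 3) * (z \<bullet> y)\<^sup>2 - \<phi>' (R - r) / r * (norm y)\<^sup>2) \<le> 0"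
    for y :: "real^'n"
  proof -
    define \<delta> where "\<delta> = e / (norm y + 1)"
    have \<delta>: "\<delta> > 0" unfolding \<delta>_def using e by (simp add: add_nonneg_pos)
    have inball: "x + t *\<^sub>R y \<in> ball x e" if "\<bar>t\<bar> < \<delta>" for t
    proof -
      have "\<bar>t\<bar> * norm y \<le> \<bar>t\<bar> * (norm y + 1)" by (simp add: mult_left_mono)
      also have "\<dots> < \<delta> * (norm y + 1)" using that by (intro mult_strict_right_mono) (auto simp: add_nonneg_pos)
      also have "\<dots> = e" unfolding \<delta>_def using norm_ge_zero[of y] by (simp add: add_nonneg_eq_0_iff)
      finally show ?thesis by (simp add: dist_norm)
    qed
    let ?n = "\<lambda>t. norm (z + t *\<^sub>R y)"
    let ?q = "\<lambda>t. ((z + t *\<^sub>R y) \<bullet> y) / ?n t"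
    have zt: "x + t *\<^sub>R y - x0 = z + t *\<^sub>R y" for t by (simp add: z_def)
    have nt: "\<rho> < ?n t" "?n t < R" if "\<bar>t\<bar> < \<delta>" for t
      using e(3)[OF inball[OF that]] by (auto simp: zt)
    have nz: "z + t *\<^sub>R y \<noteq> 0" if "\<bar>t\<bar> < \<delta>" for t using nt[OF that] \<rho> by auto
    have n0: "norm z = r" by (simp add: z_def r_def)
    define h where "h t = u (x + t *\<^sub>R y) + \<epsilon> * \<phi> (R - ?n t)" for t
    define h' where "h' t = (\<Sum>i\<in>UNIV. y $ i * partial_deriv i u (x + t *\<^sub>R y)) - \<epsilon> * (\<phi>' (R - ?n t) * ?q t)" for t
    have dn: "((\<lambda>t. R - ?n t) has_real_derivative - ?q t) (at t)" if "\<bar>t\<bar> < \<delta>" for t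
      using DERIV_diff[OF DERIV_const radial_derivatives(1)[OF nz[OF that]]] by simp
    have h: "(h has_real_derivative h' t) (at t)" if t: "\<bar>t\<bar> < \<delta>" for t
    proof -
      have "(\<phi> has_real_derivative \<phi>' (R - ?n t)) (at (R - ?n t))"
        using nt[OF t] by (intro \<phi>) auto
      from DERIV_chain2[OF this dn[OF t]]
      have "((\<lambda>t. \<epsilon> * \<phi> (R - ?n t)) has_real_derivative \<epsilon> * (\<phi>' (R - ?n t) * - ?q t)) (at t)"
        by (rule DERIV_cmult)
      moreover have "((\<lambda>t. u (x + t *\<^sub>R y)) has_real_derivative (\<Sum>i\<in>UNIV. y $ i * partial_deriv i u (x + t *\<^sub>R y))) (at t)"
        using inball[OF t] e(2) by (intro has_real_derivative_line diff) blast
      ultimately show ?thesis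
        unfolding h_def[abs_def] h'_def using DERIV_add by fastforce
    qed
    define l where "l = (\<Sum>i\<in>UNIV. y $ i * (\<Sum>j\<in>UNIV. y $ j * partial_deriv j (partial_deriv i u) x))
       - \<epsilon> * (\<phi>'' (R - r) * - (z \<bullet> y / r) * (z \<bullet> y / r) + ((norm y)\<^sup>2 / r - (z \<bullet> y)\<^sup>2 / r ^ 3) * \<phi>' (R - r))"
    have h': "(h' has_real_derivative l) (at 0)"
    proof -
      have "(\<phi>' has_real_derivative \<phi>'' (R - ?n 0)) (at (R - ?n 0))"
        using r by (intro \<phi>') (auto simp: n0)
      from DERIV_chain2[OF this dn[of 0]] \<delta>
      have d1: "((\<lambda>t. \<phi>' (R - ?n t)) has_real_derivative \<phi>'' (R - ?n 0) * - ?q 0) (at 0)" by simp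
      have d2: "((\<lambda>t. \<epsilon> * (\<phi>' (R - ?n t) * ?q t)) has_real_derivative
           \<epsilon> * (\<phi>'' (R - ?n 0) * - ?q 0 * ?q 0 + ((norm y)\<^sup>2 / ?n 0 - ((z + 0 *\<^sub>R y) \<bullet> y)\<^sup>2 / ?n 0 ^ 3) * \<phi>' (R - ?n 0))) (at 0)"
        using DERIV_mult[OF d1 radial_derivatives(2)[OF nz[of 0]]] \<delta> by (intro DERIV_cmult) simp
      have "((\<lambda>t. y $ i * partial_deriv i u (x + t *\<^sub>R y)) has_real_derivative
             y $ i * (\<Sum>j\<in>UNIV. y $ j * partial_deriv j (partial_deriv i u) (x + 0 *\<^sub>R y))) (at 0)" for i
        using x e(2) by (intro DERIV_cmult has_real_derivative_line diff2) auto
      then have "((\<lambda>t. \<Sum>i\<in>UNIV. y $ i * partial_deriv i u (x + t *\<^sub>R y)) has_real_derivative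
             (\<Sum>i\<in>UNIV. y $ i * (\<Sum>j\<in>UNIV. y $ j * partial_deriv j (partial_deriv i u) (x + 0 *\<^sub>R y)))) (at 0)"
        by (intro DERIV_sum) auto
      from DERIV_diff[OF this d2] show ?thesis
        unfolding h'_def[abs_def] l_def by (simp add: n0)
    qed
    have le: "h t \<le> h 0" if "\<bar>t\<bar> < \<delta>" for t
      using max[OF inball[OF that]] unfolding h_def by (simp add: zt n0)
    have "h' 0 = 0" "l \<le> 0"
      using second_derivative_nonpos_at_local_max[OF \<delta> h h' le] by auto
    moreover have "h' 0 = (\<Sum>i\<in>UNIV. y $ i * partial_deriv i u x) - \<epsilon> * \<phi>' (R - r) * (z \<bullet> y) / r"
      unfolding h'_def by (simp add: n0)
    moreover have "l = (\<Sum>i\<in>UNIV. \<Sum>j\<in>UNIV. partial_deriv j (partial_deriv i u) x * y $ i * y $ j)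
       + \<epsilon> * ((\<phi>'' (R - r) / r\<^sup>2 + \<phi>' (R - r) / r ^ 3) * (z \<bullet> y)\<^sup>2 - \<phi>' (R - r) / r * (norm y)\<^sup>2)"
    proof -
      have "(\<Sum>i\<in>UNIV. y $ i * (\<Sum>j\<in>UNIV. y $ j * partial_deriv j (partial_deriv i u) x))
          = (\<Sum>i\<in>UNIV. \<Sum>j\<in>UNIV. partial_deriv j (partial_deriv i u) x * y $ i * y $ j)"
        by (simp add: sum_distrib_left mult_ac)
      then show ?thesis unfolding l_def using rpos
        by (simp add: field_simps power2_eq_square power3_eq_cube)
    qed
    ultimately show ?thesis by simp
  qed
  have "(\<Sum>k\<in>UNIV. axis i 1 $ k * partial_deriv k u x) = partial_deriv i u x"
    by (simp add: axis_def if_distrib[of "\<lambda>z. z * _"] cong: if_cong)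
  moreover have "z \<bullet> axis i 1 = z $ i" by (simp add: inner_axis)
  ultimately show "partial_deriv i u x = \<epsilon> * \<phi>' (R - r) * (x - x0) $ i / r"
    using line_max[of "axis i 1"] by (simp add: z_def)
  show "(\<Sum>i\<in>UNIV. \<Sum>j\<in>UNIV. partial_deriv j (partial_deriv i u) x * y $ i * y $ j)
       + \<epsilon> * ((\<phi>'' (R - r) / r\<^sup>2 + \<phi>' (R - r) / r ^ 3) * ((x - x0) \<bullet> y)\<^sup>2 - \<phi>' (R - r) / r * (norm y)\<^sup>2) \<le> 0"
    using line_max[of y] by (simp add: z_def)
qed

lemma double_sum_affine:
  fixes F G K :: "'i \<Rightarrow> 'j \<Rightarrow> real"
  shows "(\<Sum>i\<in>A. \<Sum>j\<in>B. F i j + \<epsilon> * (\<alpha> * G i j - \<beta> * K i j))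
    = (\<Sum>i\<in>A. \<Sum>j\<in>B. F i j) + \<epsilon> * (\<alpha> * (\<Sum>i\<in>A. \<Sum>j\<in>B. G i j) - \<beta> * (\<Sum>i\<in>A. \<Sum>j\<in>B. K i j))"
  by (simp add: sum.distrib sum_subtractf flip: sum_distrib_left)

text \<open>
  The factor in the equation for \<open>\<phi>''\<close> is the sum of the unfavourable contributions to the operator
  applied to the barrier, each measured in units of \<open>\<Lambda> \<phi>'\<close>: the tangential second derivatives cost at
  most \<open>2 n / R\<close>, the first-order terms \<open>n\<close> and the zeroth-order term \<open>1\<close>. The remaining \<open>1\<close> makes the
  barrier strict. A positive \<open>c x\<close> is harmless when \<open>u x \<le> 0\<close>, since \<open>c x * u x\<close> is then not positive;
  this covers the case of a supremum equal to zero. When \<open>c x < 0\<close> and \<open>u x < 0\<close>, positivity of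
  \<open>u + \<epsilon> \<phi>\<close> gives \<open>- u x < \<epsilon> \<phi>\<close>, and the bound on \<open>\<phi>\<close> by its derivative compensates the factor
  \<open>1 / (R - r)\<close> in the bound on \<open>c\<close>.
\<close>

lemma no_positive_interior_max:
  fixes u :: "real^'n::finite \<Rightarrow> real" and x x0 :: "real^'n"
  defines "r \<equiv> norm (x - x0)"
  assumes "open \<Omega>" and C2: "C2_on \<Omega> u"
    and e: "e > 0" "ball x e \<subseteq> \<Omega>" "\<And>y. y \<in> ball x e \<Longrightarrow> R/2 < norm (y - x0) \<and> norm (y - x0) < R"
    and "R > 0" "\<epsilon> > 0"
    and \<phi>: "\<And>t. t \<in> {0<..<R/2} \<Longrightarrow> (\<phi> has_real_derivative \<phi>' t) (at t)"
    and \<phi>': "\<And>t. t \<in> {0<..<R/2} \<Longrightarrow>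
          (\<phi>' has_real_derivative (2 * CARD('n) / R + CARD('n) + 2) * \<Lambda> t * \<phi>' t) (at t)"
    and \<phi>_le: "\<And>t. t \<in> {0<..<R/2} \<Longrightarrow> \<phi> t \<le> t * \<phi>' t"
    and \<phi>'_pos: "\<And>t. t \<in> {0<..<R/2} \<Longrightarrow> 0 < \<phi>' t"
    and max: "\<And>y. y \<in> ball x e \<Longrightarrow> u y + \<epsilon> * \<phi> (R - norm (y - x0)) \<le> u x + \<epsilon> * \<phi> (R - r)"
    and \<Lambda>: "0 < \<Lambda> (R - r)"
    and ell: "\<And>y. (norm y)\<^sup>2 \<le> quad_form a x y" "\<And>y. quad_form a x y \<le> \<Lambda> (R - r) * (norm y)\<^sup>2"
    and b: "\<And>i. \<bar>b i x\<bar> \<le> \<Lambda> (R - r)"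
    and c: "c x \<ge> - \<Lambda> (R - r) / (R - r)"
    and L: "diff_op a b c u x \<ge> 0"
    and sgn: "u x \<le> 0 \<or> c x \<le> 0"
  shows "u x + \<epsilon> * \<phi> (R - r) \<le> 0"
proof (rule ccontr)
  assume pos: "\<not> ?thesis"
  define d where "d = R - r"
  define n where "n = real CARD('n)"
  define z where "z = x - x0"
  have "x \<in> ball x e" using e by simp
  then have r: "R/2 < r" "r < R" using e(3) by (auto simp: r_def)
  have d: "d \<in> {0<..<R/2}" using r by (simp add: d_def)
  have rpos: "r > 0" and n0: "n \<ge> 0" using r \<open>R > 0\<close> by (auto simp: n_def)
  note P = \<phi>'_pos[OF d]
  let ?L = "\<Lambda> d" and ?p = "\<phi>' d"
  have Lpos: "?L > 0" using \<Lambda> by (simp add: d_def)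
  define \<alpha> where "\<alpha> = (2 * n / R + n + 2) * ?L * ?p / r\<^sup>2 + ?p / r ^ 3"
  define \<beta> where "\<beta> = ?p / r"
  define \<phi>'' where "\<phi>'' t = (2 * n / R + n + 2) * \<Lambda> t * \<phi>' t" for t
  have x\<Omega>: "x \<in> \<Omega>" using e by auto
  have grad: "partial_deriv i u x = \<epsilon> * ?p * z $ i / r" for i
    unfolding d_def z_def r_def
    by (rule radial_perturbation_at_max(1)[where \<Omega>=\<Omega> and e=e and \<rho>="R/2" and \<phi>=\<phi> and \<phi>''=\<phi>''])
      (use assms \<open>R > 0\<close> in \<open>auto simp: \<phi>''_def n_def\<close>)
  have hess: "(\<Sum>i\<in>UNIV. \<Sum>j\<in>UNIV. partial_deriv j (partial_deriv i u) x * y $ i * y $ j)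
       + \<epsilon> * (\<alpha> * (z \<bullet> y)\<^sup>2 - \<beta> * (norm y)\<^sup>2) \<le> 0" for y
  proof -
    have "(\<Sum>i\<in>UNIV. \<Sum>j\<in>UNIV. partial_deriv j (partial_deriv i u) x * y $ i * y $ j)
       + \<epsilon> * ((\<phi>'' d / r\<^sup>2 + \<phi>' d / r ^ 3) * (z \<bullet> y)\<^sup>2 - \<phi>' d / r * (norm y)\<^sup>2) \<le> 0"
      unfolding d_def z_def r_def
      by (rule radial_perturbation_at_max(2)[where \<Omega>=\<Omega> and e=e and \<rho>="R/2" and \<phi>=\<phi> and \<phi>''=\<phi>''])
        (use assms \<open>R > 0\<close> in \<open>auto simp: \<phi>''_def n_def\<close>)
    then show ?thesis by (simp add: \<alpha>_def \<beta>_def \<phi>''_def)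
  qed
  \<comment> \<open>\<open>H\<close> is the Hessian at \<open>x\<close> of \<open>u\<close> plus the barrier.\<close>
  define H where "H i j = partial_deriv j (partial_deriv i u) x + \<epsilon> * (\<alpha> * z $ i * z $ j - (if i = j then \<beta> else 0))" for i j
  have "(\<Sum>i\<in>UNIV. \<Sum>j\<in>UNIV. a i j x * H i j) \<le> 0"
  proof (rule elliptic_trace_nonpos)
    show "H i j = H j i" for i j
      unfolding H_def using mixed_partials_commute[OF \<open>open \<Omega>\<close> C2 x\<Omega>, of i j] by simp
    show "(\<Sum>i\<in>UNIV. \<Sum>j\<in>UNIV. H i j * y $ i * y $ j) \<le> 0" for y :: "real^'n"
    proof -
      have 1: "(z \<bullet> y)\<^sup>2 = (\<Sum>i\<in>UNIV. \<Sum>j\<in>UNIV. z $ i * z $ j * y $ i * y $ j)"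
        by (simp add: power2_eq_square inner_vec_def sum_product mult_ac)
      have 2: "(norm y)\<^sup>2 = (\<Sum>i\<in>UNIV. \<Sum>j\<in>UNIV. (if i = j then 1 else 0) * y $ i * y $ j)"
        by (simp add: power2_norm_eq_inner inner_vec_def if_distrib[of "\<lambda>z. z * _"] cong: if_cong)
      have "(\<Sum>i\<in>UNIV. \<Sum>j\<in>UNIV. H i j * y $ i * y $ j)
        = (\<Sum>i\<in>UNIV. \<Sum>j\<in>UNIV. partial_deriv j (partial_deriv i u) x * y $ i * y $ j
            + \<epsilon> * (\<alpha> * (z $ i * z $ j * y $ i * y $ j) - \<beta> * ((if i = j then 1 else 0) * y $ i * y $ j)))"
        unfolding H_def by (intro sum.cong refl) (auto simp: algebra_simps)
      also have "\<dots> = (\<Sum>i\<in>UNIV. \<Sum>j\<in>UNIV. partial_deriv j (partial_deriv i u) x * y $ i * y $ j)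
       + \<epsilon> * (\<alpha> * (z \<bullet> y)\<^sup>2 - \<beta> * (norm y)\<^sup>2)"
        unfolding 1 2 by (rule double_sum_affine)
      finally show ?thesis using hess[of y] by simp
    qed
  qed (rule ell)
  moreover have "(\<Sum>i\<in>UNIV. \<Sum>j\<in>UNIV. a i j x * H i j)
     = (\<Sum>i\<in>UNIV. \<Sum>j\<in>UNIV. a i j x * partial_deriv j (partial_deriv i u) x)
      + \<epsilon> * (\<alpha> * quad_form a x z - \<beta> * (\<Sum>i\<in>UNIV. a i i x))"
  proof -
    have tr: "(\<Sum>i\<in>UNIV. a i i x) = (\<Sum>i\<in>UNIV. \<Sum>j\<in>UNIV. if i = j then a i j x else 0)"
      by simp
    have "(\<Sum>i\<in>UNIV. \<Sum>j\<in>UNIV. a i j x * H i j)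
      = (\<Sum>i\<in>UNIV. \<Sum>j\<in>UNIV. a i j x * partial_deriv j (partial_deriv i u) x
          + \<epsilon> * (\<alpha> * (a i j x * z $ i * z $ j) - \<beta> * (if i = j then a i j x else 0)))"
      unfolding H_def by (intro sum.cong refl) (auto simp: algebra_simps)
    then show ?thesis
      unfolding tr quad_form_def by (simp only: double_sum_affine)
  qed
  moreover have radial: "\<alpha> * quad_form a x z \<ge> (2 * n / R + n + 2) * ?L * ?p"
  proof -
    have "\<alpha> \<ge> 0" unfolding \<alpha>_def using P Lpos rpos n0 \<open>R > 0\<close> by simp
    then have "\<alpha> * quad_form a x z \<ge> \<alpha> * r\<^sup>2"
      using ell(1)[of z] by (intro mult_left_mono) (auto simp: z_def r_def)
    moreover have "\<alpha> * r\<^sup>2 = (2 * n / R + n + 2) * ?L * ?p + ?p / r"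
      unfolding \<alpha>_def using rpos by (simp add: field_simps power2_eq_square power3_eq_cube)
    moreover have "?p / r \<ge> 0" using P rpos by simp
    ultimately show ?thesis by linarith
  qed
  moreover have trace: "\<beta> * (\<Sum>i\<in>UNIV. a i i x) \<le> (2 * n / R) * ?L * ?p"
  proof -
    have "a i i x \<le> ?L" for i
    proof -
      have "quad_form a x (axis i 1) = a i i x"
        unfolding quad_form_def axis_def
        by (simp add: if_distrib[of "\<lambda>z. _ * z"] if_distrib[of "\<lambda>z. z * _"] cong: if_cong)
      then show ?thesis using ell(2)[of "axis i 1"] by (simp add: d_def)
    qed
    then have "(\<Sum>i\<in>UNIV. a i i x) \<le> n * ?L"
      unfolding n_def using sum_bounded_above[of UNIV "\<lambda>i. a i i x" ?L] by simp
    moreover have "0 \<le> \<beta>" unfolding \<beta>_def using P rpos by simp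
    ultimately have "\<beta> * (\<Sum>i\<in>UNIV. a i i x) \<le> \<beta> * (n * ?L)" by (intro mult_left_mono)
    also have "\<beta> \<le> ?p * (2 / R)"
    proof -
      have "1 / r \<le> 2 / R" using r \<open>R > 0\<close> rpos by (simp add: field_simps)
      then have "?p * (1 / r) \<le> ?p * (2 / R)" using P by (intro mult_left_mono) auto
      then show ?thesis by (simp add: \<beta>_def)
    qed
    then have "\<beta> * (n * ?L) \<le> ?p * (2 / R) * (n * ?L)"
      using n0 Lpos by (intro mult_right_mono) auto
    finally show ?thesis by (simp add: mult_ac)
  qed
  moreover have "(\<Sum>i\<in>UNIV. b i x * partial_deriv i u x) \<le> \<epsilon> * (n * ?L * ?p)"
  proof -
    have "b i x * partial_deriv i u x \<le> \<epsilon> * ?p * ?L" for i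
    proof -
      have "\<bar>z $ i\<bar> \<le> r" using component_le_norm_cart[of z i] by (simp add: z_def r_def)
      then have "\<bar>z $ i / r\<bar> \<le> 1" using rpos by simp
      then have "\<bar>b i x\<bar> * \<bar>z $ i / r\<bar> \<le> ?L * 1"
        using b[of i] by (intro mult_mono) (auto simp: d_def)
      then have "b i x * (z $ i / r) \<le> ?L" by (metis abs_le_D1 abs_mult mult.right_neutral)
      then have "(\<epsilon> * ?p) * (b i x * (z $ i / r)) \<le> (\<epsilon> * ?p) * ?L"
        using \<open>\<epsilon> > 0\<close> P by (intro mult_left_mono) auto
      then show ?thesis by (simp add: grad mult_ac)
    qed
    then have "(\<Sum>i\<in>UNIV. b i x * partial_deriv i u x) \<le> n * (\<epsilon> * ?p * ?L)"
      unfolding n_def using sum_bounded_above[of UNIV "\<lambda>i. b i x * partial_deriv i u x"] by simp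
    then show ?thesis by (simp add: mult_ac)
  qed
  moreover have "c x * u x \<le> \<epsilon> * (?L * ?p)"
  proof -
    have uge: "- u x < \<epsilon> * \<phi> d" using pos by (simp add: d_def)
    have dpos: "d > 0" using d by simp
    have rhs: "0 \<le> \<epsilon> * (?L * ?p)" using \<open>\<epsilon> > 0\<close> P Lpos by simp
    show ?thesis
    proof (cases "u x \<ge> 0 \<longleftrightarrow> c x \<ge> 0")
      case False
      then have "c x * u x \<le> 0" by (auto simp: mult_le_0_iff)
      then show ?thesis using rhs by linarith
    next
      case True
      show ?thesis
      proof (cases "u x \<ge> 0")
        case True
        then have "c x * u x = 0"
          using \<open>(u x \<ge> 0) = (c x \<ge> 0)\<close> sgn by auto
        then show ?thesis using rhs by linarith
      next
        case False
        with \<open>(u x \<ge> 0) = (c x \<ge> 0)\<close> have neg: "u x < 0" "c x < 0" by auto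
        have "(- c x) * (- u x) \<le> (?L / d) * (\<epsilon> * \<phi> d)"
          using c neg uge Lpos dpos by (intro mult_mono) (auto simp: d_def)
        also have "\<dots> \<le> (?L / d) * (\<epsilon> * (d * ?p))"
          using \<phi>_le[OF d] Lpos dpos \<open>\<epsilon> > 0\<close> by (intro mult_left_mono) auto
        also have "\<dots> = \<epsilon> * (?L * ?p)" using dpos by simp
        finally show ?thesis by simp
      qed
    qed
  qed
  moreover have "(\<Sum>i\<in>UNIV. \<Sum>j\<in>UNIV. a i j x * partial_deriv j (partial_deriv i u) x)
     + (\<Sum>i\<in>UNIV. b i x * partial_deriv i u x) + c x * u x \<ge> 0"
    using L by (simp add: diff_op_def)
  moreover have "\<epsilon> * (\<alpha> * quad_form a x z - \<beta> * (\<Sum>i\<in>UNIV. a i i x))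
      \<ge> \<epsilon> * ((2 * n / R + n + 2) * ?L * ?p - (2 * n / R) * ?L * ?p)"
    using radial trace \<open>\<epsilon> > 0\<close> by (intro mult_left_mono) auto
  moreover have "\<epsilon> * ((2 * n / R + n + 2) * ?L * ?p - (2 * n / R) * ?L * ?p)
      = \<epsilon> * (n * ?L * ?p) + \<epsilon> * (?L * ?p) + \<epsilon> * (?L * ?p)"
    by (simp add: algebra_simps)
  moreover have "\<epsilon> * (?L * ?p) > 0" using \<open>\<epsilon> > 0\<close> P Lpos by simp
  ultimately show False by linarith
qed

section \<open>The boundary point lemma\<close>

text \<open>
  Comparison on the closed annulus \<open>R/2 \<le> dist x0 x \<le> R\<close>: the function \<open>u + \<epsilon> \<phi> (R - dist x0 x)\<close> does
  not exceed \<open>M\<close> on either boundary sphere, and a maximum inside the annulus would be nonpositive,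
  hence again at most \<open>M\<close>.
\<close>

lemma hopf_linear_decay:
  fixes u :: "real^'n::finite \<Rightarrow> real"
  assumes "open \<Omega>" and C2: "C2_on \<Omega> u"
    and R: "R > 0" and sub: "ball x0 R \<subseteq> \<Omega>" and cont: "continuous_on (cball x0 R) u"
    and L: "\<And>x. x \<in> ball x0 R \<Longrightarrow> diff_op a b c u x \<ge> 0"
    and \<Lambda>: "continuous_on {0<..R/2} \<Lambda>" "\<And>t. t \<in> {0<..R/2} \<Longrightarrow> \<Lambda> t > 0" "\<Lambda> integrable_on {0<..R/2}"
    and coeff: "\<And>x. x \<in> ball x0 R \<Longrightarrow> infdist x (sphere x0 R) \<le> R/2 \<Longrightarrow>
        (\<forall>y. (norm y)\<^sup>2 \<le> quad_form a x y \<and> quad_form a x y \<le> \<Lambda> (infdist x (sphere x0 R)) * (norm y)\<^sup>2) \<and>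
        (\<forall>i. \<bar>b i x\<bar> \<le> \<Lambda> (infdist x (sphere x0 R))) \<and>
        c x \<ge> - \<Lambda> (infdist x (sphere x0 R)) / infdist x (sphere x0 R)"
    and sgn: "M = 0 \<or> (M > 0 \<and> (\<forall>x\<in>ball x0 R. c x \<le> 0))"
    and less: "\<And>x. x \<in> ball x0 R \<Longrightarrow> u x < M"
    and le: "\<And>x. x \<in> sphere x0 R \<Longrightarrow> u x \<le> M"
  obtains \<epsilon> where "\<epsilon> > 0" "\<And>x. R/2 \<le> dist x0 x \<Longrightarrow> dist x0 x \<le> R \<Longrightarrow> u x \<le> M - \<epsilon> * (R - dist x0 x)"
proof -
  define K where "K = 2 * real CARD('n) / R + real CARD('n) + 2"
  have "R/2 > 0" "K \<ge> 0" using R by (auto simp: K_def)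
  then obtain \<phi> \<phi>' where
    \<phi>_cont: "continuous_on {0..R/2} \<phi>" and \<phi>0: "\<phi> 0 = 0"
    and \<phi>: "\<And>t. t \<in> {0<..<R/2} \<Longrightarrow> (\<phi> has_real_derivative \<phi>' t) (at t)"
    and \<phi>': "\<And>t. t \<in> {0<..<R/2} \<Longrightarrow> (\<phi>' has_real_derivative K * \<Lambda> t * \<phi>' t) (at t)"
    and \<phi>_ge: "\<And>t. t \<in> {0..R/2} \<Longrightarrow> t \<le> \<phi> t"
    and \<phi>_le: "\<And>t. t \<in> {0..R/2} \<Longrightarrow> \<phi> t \<le> t * \<phi>' t"
    and \<phi>'_ge: "\<And>t. t \<in> {0..R/2} \<Longrightarrow> 1 \<le> \<phi>' t"
    using barrier_profile[OF _ _ \<Lambda>] by blast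
  \<comment> \<open>On the inner sphere \<open>u\<close> stays below \<open>M\<close> by a fixed gap, which leaves room for a small multiple
    of the barrier. The outer sphere needs no room, because the barrier vanishes there.\<close>
  have "\<exists>\<epsilon>>0. \<forall>x\<in>sphere x0 (R/2). u x + \<epsilon> * \<phi> (R/2) \<le> M"
  proof (cases "sphere x0 (R/2) = {}")
    case True
    then show ?thesis by (intro exI[of _ 1]) auto
  next
    case False
    have "continuous_on (sphere x0 (R/2)) u"
      using R by (intro continuous_on_subset[OF cont]) auto
    then obtain q where q: "q \<in> sphere x0 (R/2)" "\<And>x. x \<in> sphere x0 (R/2) \<Longrightarrow> u x \<le> u q"
      using continuous_attains_sup[OF compact_sphere False] by blast
    have gap: "M - u q > 0" using less[of q] q R by auto
    have \<phi>2: "\<phi> (R/2) > 0" using \<phi>_ge[of "R/2"] R by auto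
    show ?thesis
    proof (intro exI[of _ "(M - u q) / \<phi> (R/2)"] conjI ballI)
      show "(M - u q) / \<phi> (R/2) > 0" using gap \<phi>2 by simp
      show "u x + (M - u q) / \<phi> (R/2) * \<phi> (R/2) \<le> M" if "x \<in> sphere x0 (R/2)" for x
        using q(2)[OF that] \<phi>2 by simp
    qed
  qed
  then obtain \<epsilon> where \<epsilon>: "\<epsilon> > 0" "\<And>x. x \<in> sphere x0 (R/2) \<Longrightarrow> u x + \<epsilon> * \<phi> (R/2) \<le> M" by blast
  define A where "A = cball x0 R - ball x0 (R/2)"
  define w where "w x = u x + \<epsilon> * \<phi> (R - norm (x - x0))" for x
  have "compact A" unfolding A_def by (intro compact_diff) auto
  have w_cont: "continuous_on A w"
  proof -
    have "continuous_on A u" by (rule continuous_on_subset[OF cont]) (auto simp: A_def)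
    moreover have "continuous_on A (\<lambda>x. \<phi> (R - norm (x - x0)))"
      by (rule continuous_on_compose2[OF \<phi>_cont]) (auto intro!: continuous_intros simp: A_def dist_norm norm_minus_commute)
    ultimately show ?thesis unfolding w_def[abs_def] by (intro continuous_intros)
  qed
  have w_le: "w y \<le> M" if "y \<in> A" for y
  proof -
    have "A \<noteq> {}" using that by blast
    obtain x where x: "x \<in> A" and max: "\<And>y. y \<in> A \<Longrightarrow> w y \<le> w x"
      using continuous_attains_sup[OF \<open>compact A\<close> \<open>A \<noteq> {}\<close> w_cont] by blast
    define r where "r = norm (x - x0)"
    have rd: "dist x0 x = r" by (simp add: r_def dist_norm norm_minus_commute)
    consider "r = R" | "r = R/2" | "R/2 < r" "r < R"
      using x by (auto simp: A_def rd) linarith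
    then have "w x \<le> M"
    proof cases
      case 1
      then show ?thesis using le[of x] \<phi>0 by (simp add: w_def rd flip: r_def)
    next
      case 2
      then have "R - r = R/2" by simp
      with 2 show ?thesis using \<epsilon>(2)[of x] by (simp add: w_def rd flip: r_def)
    next
      case 3
      define e where "e = min (r - R/2) (R - r)"
      have e: "e > 0" using 3 by (simp add: e_def)
      have near: "R/2 < norm (y - x0) \<and> norm (y - x0) < R" if "y \<in> ball x e" for y
      proof -
        have "\<bar>norm (y - x0) - r\<bar> \<le> norm (y - x)"
          unfolding r_def using norm_triangle_ineq3[of "y - x0" "x - x0"] by simp
        then show ?thesis using that unfolding e_def by (auto simp: dist_norm norm_minus_commute)
      qed
      have nearA: "ball x e \<subseteq> A" "ball x e \<subseteq> \<Omega>"
        using near sub by (force simp: A_def dist_norm norm_minus_commute)+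
      have xb: "x \<in> ball x0 R" using 3 rd by simp
      have inf: "infdist x (sphere x0 R) = R - r"
      proof -
        have "x \<noteq> x0" using 3 R by (auto simp: r_def)
        from infdist_sphere[OF this, of R] 3 rd show ?thesis by simp
      qed
      have t: "R - r \<in> {0<..R/2}" using 3 by simp
      have ux: "u x < M" by (rule less[OF xb])
      have cf: "(norm y)\<^sup>2 \<le> quad_form a x y" "quad_form a x y \<le> \<Lambda> (R - r) * (norm y)\<^sup>2"
        "\<bar>b i x\<bar> \<le> \<Lambda> (R - r)" "c x \<ge> - \<Lambda> (R - r) / (R - r)" for y i
        using coeff[OF xb] t unfolding inf by auto
      have "u x + \<epsilon> * \<phi> (R - norm (x - x0)) \<le> 0"
      proof (rule no_positive_interior_max[where \<Omega>=\<Omega> and a=a and b=b and c=c and \<Lambda>=\<Lambda> and e=e and \<phi>'=\<phi>'])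
        show "u x \<le> 0 \<or> c x \<le> 0" using sgn ux xb by auto
        show "u y + \<epsilon> * \<phi> (R - norm (y - x0)) \<le> u x + \<epsilon> * \<phi> (R - norm (x - x0))" if "y \<in> ball x e" for y
          using max[of y] that nearA by (auto simp: w_def)
        show "\<phi> t \<le> t * \<phi>' t" "0 < \<phi>' t" if "t \<in> {0<..<R/2}" for t
          using \<phi>_le[of t] \<phi>'_ge[of t] that by auto
      qed (use assms e near nearA \<epsilon> \<phi> \<phi>' cf L[OF xb] t in \<open>simp_all add: K_def flip: r_def\<close>)
      then show ?thesis using sgn by (auto simp: w_def)
    qed
    then show ?thesis using max[OF that] by simp
  qed
  show thesis
  proof (rule that[OF \<epsilon>(1)])
    fix x assume x: "R/2 \<le> dist x0 x" "dist x0 x \<le> R"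
    have "\<epsilon> * (R - dist x0 x) \<le> \<epsilon> * \<phi> (R - dist x0 x)"
      using \<epsilon>(1) x by (intro mult_left_mono \<phi>_ge) auto
    moreover have "w x \<le> M" using w_le[of x] x by (simp add: A_def)
    ultimately show "u x \<le> M - \<epsilon> * (R - dist x0 x)"
      by (simp add: w_def dist_norm norm_minus_commute)
  qed
qed

lemma outward_derivative_exists:
  fixes u :: "real^'n::finite \<Rightarrow> real"
  assumes C1: "C1_closure \<Omega> u" and R: "R > 0" and sub: "ball x0 R \<subseteq> \<Omega>" and p: "p \<in> sphere x0 R"
  obtains D where "has_outward_derivative u p ((p - x0) /\<^sub>R R) D"
proof -
  define \<nu> where "\<nu> = (p - x0) /\<^sub>R R"
  have p_eq: "p = x0 + R *\<^sub>R \<nu>" using R by (simp add: \<nu>_def)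
  have \<nu>: "norm \<nu> = 1" using p R by (simp add: \<nu>_def dist_norm norm_minus_commute divide_inverse mult.commute)
  have cl: "cball x0 R \<subseteq> closure \<Omega>"
    using closure_mono[OF sub] R by simp
  have line: "p + t *\<^sub>R \<nu> \<in> cball x0 R" if "t \<in> {-R..0}" for t
  proof -
    have "x0 - (p + t *\<^sub>R \<nu>) = - ((R + t) *\<^sub>R \<nu>)" by (simp add: p_eq algebra_simps)
    then show ?thesis using that \<nu> by (simp add: dist_norm)
  qed
  have line_in: "p + t *\<^sub>R \<nu> \<in> \<Omega>" if "t \<in> {-R<..<0}" for t
  proof -
    have "x0 - (p + t *\<^sub>R \<nu>) = - ((R + t) *\<^sub>R \<nu>)" by (simp add: p_eq algebra_simps)
    then have "p + t *\<^sub>R \<nu> \<in> ball x0 R" using that \<nu> by (simp add: dist_norm)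
    then show ?thesis using sub by blast
  qed
  from C1 have diff: "\<And>x. x \<in> \<Omega> \<Longrightarrow> u differentiable (at x)" and cont: "continuous_on (closure \<Omega>) u"
    and "\<forall>i. \<exists>g. continuous_on (closure \<Omega>) g \<and> (\<forall>x\<in>\<Omega>. g x = partial_deriv i u x)"
    by (auto simp: C1_closure_def C1_on_def)
  then obtain g where g: "\<And>i. continuous_on (closure \<Omega>) (g i)" "\<And>i x. x \<in> \<Omega> \<Longrightarrow> g i x = partial_deriv i u x"
    by metis
  have along: "continuous_on {-R..0} (\<lambda>t. f (p + t *\<^sub>R \<nu>))" if "continuous_on (closure \<Omega>) f" for f :: "real^'n \<Rightarrow> real"
    using line cl by (intro continuous_on_compose2[OF that] continuous_intros) auto
  define h' where "h' t = (\<Sum>i\<in>UNIV. \<nu> $ i * g i (p + t *\<^sub>R \<nu>))" for t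
  have "continuous_on {-R..0} h'"
    unfolding h'_def[abs_def] by (intro continuous_intros along g)
  then have "(h' \<longlongrightarrow> h' 0) (at 0 within {-R..0})"
    using R by (simp add: continuous_on_def)
  moreover have "at 0 within {-R..0} = at_left (0::real)"
    using R by (rule at_within_Icc_at_left[of "-R" 0, simplified])
  ultimately have lim: "(h' \<longlongrightarrow> h' 0) (at_left 0)" by simp
  have "((\<lambda>t. u (p + t *\<^sub>R \<nu>)) has_real_derivative h' 0) (at 0 within {..0})"
  proof (rule one_sided_derivative_from_limit[OF R along[OF cont] _ lim])
    fix t assume "t \<in> {-R<..<0}"
    then show "((\<lambda>t. u (p + t *\<^sub>R \<nu>)) has_real_derivative h' t) (at t)"
      using has_real_derivative_line[OF diff[OF line_in]] line_in g by (simp add: h'_def)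
  qed
  then show thesis using that unfolding has_outward_derivative_def \<nu>_def by blast
qed

text \<open>
  The Hopf boundary point lemma: linear decay along the inner normal bounds the outward derivative
  below by a positive constant. It is stated for any point of the sphere, interior to
  \<open>\<Omega>\<close> or not: at an interior point it excludes a maximum, at a boundary point it is the final
  conclusion.
\<close>

lemma hopf_boundary_point:
  fixes u :: "real^'n::finite \<Rightarrow> real"
  assumes "open \<Omega>" "C2_on \<Omega> u" "C1_closure \<Omega> u"
    and R: "R > 0" and sub: "ball x0 R \<subseteq> \<Omega> - S"
    and L: "\<And>x. x \<in> \<Omega> - S \<Longrightarrow> diff_op a b c u x \<ge> 0"
    and coeff: "\<exists>\<Lambda> :: real \<Rightarrow> real.
             continuous_on {0<..R/2} \<Lambda> \<and> antimono_on {0<..R/2} \<Lambda> \<and>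
             (\<forall>t\<in>{0<..R/2}. \<Lambda> t > 0) \<and>
             \<Lambda> absolutely_integrable_on {0<..R/2} \<and>
             (\<forall>x \<in> ball x0 R. let d = infdist x (sphere x0 R) in d \<le> R/2 \<longrightarrow>
                (\<forall>y. (norm y)\<^sup>2 \<le> quad_form a x y \<and> quad_form a x y \<le> \<Lambda> d * (norm y)\<^sup>2) \<and>
                (\<forall>i. \<bar>b i x\<bar> \<le> \<Lambda> d) \<and>
                c x \<ge> - \<Lambda> d / d)"
    and sgn: "M = 0 \<or> (M > 0 \<and> (\<forall>x\<in>\<Omega> - S. c x \<le> 0))"
    and less: "\<And>x. x \<in> ball x0 R \<Longrightarrow> u x < M"
    and le: "\<And>x. x \<in> closure \<Omega> \<Longrightarrow> u x \<le> M"
    and p: "p \<in> sphere x0 R" "u p = M"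
  shows "\<exists>D>0. has_outward_derivative u p ((p - x0) /\<^sub>R R) D"
proof -
  define \<nu> where "\<nu> = (p - x0) /\<^sub>R R"
  have sub': "ball x0 R \<subseteq> \<Omega>" using sub by blast
  have cl: "cball x0 R \<subseteq> closure \<Omega>" using closure_mono[OF sub'] R by simp
  obtain \<Lambda> where \<Lambda>: "continuous_on {0<..R/2} \<Lambda>" "\<And>t. t \<in> {0<..R/2} \<Longrightarrow> \<Lambda> t > 0" "\<Lambda> integrable_on {0<..R/2}"
    and cf: "\<And>x. x \<in> ball x0 R \<Longrightarrow> infdist x (sphere x0 R) \<le> R/2 \<Longrightarrow>
        (\<forall>y. (norm y)\<^sup>2 \<le> quad_form a x y \<and> quad_form a x y \<le> \<Lambda> (infdist x (sphere x0 R)) * (norm y)\<^sup>2) \<and>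
        (\<forall>i. \<bar>b i x\<bar> \<le> \<Lambda> (infdist x (sphere x0 R))) \<and>
        c x \<ge> - \<Lambda> (infdist x (sphere x0 R)) / infdist x (sphere x0 R)"
    using coeff unfolding Let_def by (auto dest: set_lebesgue_integral_eq_integral(1))
  have cont: "continuous_on (cball x0 R) u"
    using \<open>C1_closure \<Omega> u\<close> cl continuous_on_subset unfolding C1_closure_def by blast
  obtain \<epsilon> where \<epsilon>: "\<epsilon> > 0" "\<And>x. R/2 \<le> dist x0 x \<Longrightarrow> dist x0 x \<le> R \<Longrightarrow> u x \<le> M - \<epsilon> * (R - dist x0 x)"
  proof (rule hopf_linear_decay[OF \<open>open \<Omega>\<close> \<open>C2_on \<Omega> u\<close> R sub' cont _ \<Lambda> cf _ less])
    show "diff_op a b c u x \<ge> 0" if "x \<in> ball x0 R" for x using L that sub by blast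
    show "M = 0 \<or> (M > 0 \<and> (\<forall>x\<in>ball x0 R. c x \<le> 0))" using sgn sub by blast
    show "u x \<le> M" if "x \<in> sphere x0 R" for x using le[of x] cl that by auto
  qed auto
  obtain D where D: "has_outward_derivative u p \<nu> D"
    unfolding \<nu>_def by (rule outward_derivative_exists[OF \<open>C1_closure \<Omega> u\<close> R sub' p(1)])
  have "\<epsilon> \<le> D"
  proof (rule outward_derivative_ge[OF D])
    show "R/2 > 0" using R by simp
    fix t assume t: "0 < t" "t < R/2"
    have \<nu>: "norm \<nu> = 1" using p R by (simp add: \<nu>_def dist_norm norm_minus_commute divide_inverse mult.commute)
    have "x0 - (p - t *\<^sub>R \<nu>) = - ((R - t) *\<^sub>R \<nu>)" using R by (simp add: \<nu>_def algebra_simps)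
    then have "dist x0 (p - t *\<^sub>R \<nu>) = R - t" using t \<nu> by (simp add: dist_norm)
    then show "u (p - t *\<^sub>R \<nu>) \<le> u p - \<epsilon> * t" using \<epsilon>(2)[of "p - t *\<^sub>R \<nu>"] t p by simp
  qed
  then show ?thesis using D \<epsilon>(1) unfolding \<nu>_def by (intro exI[of _ D]) auto
qed

lemma outward_derivative_at_interior_max:
  fixes u :: "real^'n::finite \<Rightarrow> real"
  assumes "open \<Omega>" "p \<in> \<Omega>" and diff: "u differentiable (at p)" and max: "\<And>x. x \<in> \<Omega> \<Longrightarrow> u x \<le> u p"
    and D: "has_outward_derivative u p \<nu> D"
  shows "D = 0"
proof -
  have "(u has_derivative frechet_derivative u (at p)) (at p)"
    using diff frechet_derivative_works by blast
  moreover then have "frechet_derivative u (at p) = (\<lambda>v. 0)"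
    using assms by (intro differential_zero_maxmin[of p \<Omega>]) auto
  ultimately have z: "\<And>i. partial_deriv i u p = 0" by (simp add: partial_deriv_def)
  have "((\<lambda>t. u (p + t *\<^sub>R \<nu>)) has_real_derivative 0) (at 0)"
    using has_real_derivative_line[of u p 0 \<nu>] diff z by simp
  then have "((\<lambda>t. u (p + t *\<^sub>R \<nu>)) has_real_derivative 0) (at 0 within {..0})"
    by (rule has_field_derivative_at_within)
  with D have lims: "((\<lambda>t. (u (p + t *\<^sub>R \<nu>) - u (p + 0 *\<^sub>R \<nu>)) / (t - 0)) \<longlongrightarrow> d) (at 0 within {..0})" if "d \<in> {0, D}" for d
    using that unfolding has_outward_derivative_def has_field_derivative_iff by auto
  have "at_left (0::real) \<le> at 0 within {..0}" by (rule at_le) auto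
  then have "((\<lambda>t. (u (p + t *\<^sub>R \<nu>) - u (p + 0 *\<^sub>R \<nu>)) / (t - 0)) \<longlongrightarrow> d) (at_left 0)" if "d \<in> {0, D}" for d
    using lims[OF that] by (rule tendsto_mono)
  from this[of D] this[of 0] show ?thesis
    using tendsto_unique[OF trivial_limit_at_left_real] by blast
qed

section \<open>Strong maximum principle and normal derivative\<close>

theorem theorem2p5:
  fixes \<Omega> S :: "(real^'n::finite) set"
    and a :: "'n \<Rightarrow> 'n \<Rightarrow> real^'n \<Rightarrow> real"
    and b :: "'n \<Rightarrow> real^'n \<Rightarrow> real"
    and c u :: "real^'n \<Rightarrow> real"
    and xb xb' :: "real^'n" and Rb :: real
  assumes "open \<Omega>" and "connected \<Omega>" and "bounded \<Omega>"
    and "S \<subseteq> \<Omega>" and "outward_ball_property \<Omega> S"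
    and "elliptic_on (\<Omega> - S) a"
    and "C2_on \<Omega> u" and "C1_closure \<Omega> u"
    and "\<And>x. x \<in> \<Omega> - S \<Longrightarrow> diff_op a b c u x \<ge> 0"
    and "\<And>x0 R. R > 0 \<Longrightarrow> ball x0 R \<subseteq> \<Omega> - S \<Longrightarrow>
           \<exists>\<Lambda> :: real \<Rightarrow> real.
             continuous_on {0<..R/2} \<Lambda> \<and> antimono_on {0<..R/2} \<Lambda> \<and>
             (\<forall>t\<in>{0<..R/2}. \<Lambda> t > 0) \<and>
             \<Lambda> absolutely_integrable_on {0<..R/2} \<and>
             (\<forall>x \<in> ball x0 R. let d = infdist x (sphere x0 R) in d \<le> R/2 \<longrightarrow>
                (\<forall>y. (norm y)\<^sup>2 \<le> quad_form a x y \<and> quad_form a x y \<le> \<Lambda> d * (norm y)\<^sup>2) \<and>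
                (\<forall>i. \<bar>b i x\<bar> \<le> \<Lambda> d) \<and>
                c x \<ge> - \<Lambda> d / d)"
    and "(SUP x\<in>\<Omega>. u x) = 0 \<or> ((SUP x\<in>\<Omega>. u x) > 0 \<and> (\<forall>x\<in>\<Omega> - S. c x \<le> 0))"
    and "xb \<in> frontier \<Omega>" and "(SUP x\<in>\<Omega>. u x) = u xb"
    and "Rb > 0" and "ball xb' Rb \<subseteq> \<Omega> - S" and "xb \<in> sphere xb' Rb"
    and "\<not> u constant_on \<Omega>"
  shows "\<exists>D>0. has_outward_derivative u xb ((xb - xb') /\<^sub>R Rb) D"
proof -
  define M where "M = (SUP x\<in>\<Omega>. u x)"
  have cont: "continuous_on (closure \<Omega>) u"
    using \<open>C1_closure \<Omega> u\<close> by (simp add: C1_closure_def)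
  have "compact (u ` closure \<Omega>)"
    using \<open>bounded \<Omega>\<close> by (intro compact_continuous_image cont) (simp add: compact_closure)
  then have "bdd_above (u ` \<Omega>)"
    using bounded_imp_bdd_above compact_imp_bounded closure_subset bdd_above_mono image_mono by metis
  then have le_\<Omega>: "u x \<le> M" if "x \<in> \<Omega>" for x
    unfolding M_def using that by (rule cSUP_upper[rotated])
  have le: "u x \<le> M" if "x \<in> closure \<Omega>" for x
    using continuous_le_on_closure[OF cont that] le_\<Omega> by blast
  have hopf: "\<exists>D>0. has_outward_derivative u p ((p - x0) /\<^sub>R R) D"
    if "R > 0" "ball x0 R \<subseteq> \<Omega> - S" "\<And>x. x \<in> ball x0 R \<Longrightarrow> u x < M" "p \<in> sphere x0 R" "u p = M"
    for R x0 p
    by (rule hopf_boundary_point[OF \<open>open \<Omega>\<close> \<open>C2_on \<Omega> u\<close> \<open>C1_closure \<Omega> u\<close> that(1,2) assms(9)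
          assms(10)[OF that(1,2)] assms(11)[folded M_def] that(3) le that(4,5)])
  \<comment> \<open>Strong maximum principle: a ball touching the set of interior maximum points from outside would
    force a positive directional derivative at a critical point.\<close>
  define T where "T = {x \<in> \<Omega>. u x = M}"
  have "T = {}"
  proof (rule ccontr)
    assume ne: "T \<noteq> {}"
    have "T \<noteq> \<Omega>"
      using \<open>\<not> u constant_on \<Omega>\<close> unfolding T_def constant_on_def by blast
    then have "T \<subset> \<Omega>" by (auto simp: T_def)
    moreover have "closedin (top_of_set \<Omega>) T"
      using continuous_closedin_preimage_constant[OF continuous_on_subset[OF cont closure_subset]]
      unfolding T_def by blast
    ultimately have "\<exists>R>0. \<exists>x0 \<in> \<Omega> - (T \<union> S). ball x0 R \<subseteq> \<Omega> - (T \<union> S) \<and> sphere x0 R \<inter> T \<noteq> {}"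
      using \<open>outward_ball_property \<Omega> S\<close> ne unfolding outward_ball_property_def by simp
    then obtain R x0 p where R: "R > 0" and sub: "ball x0 R \<subseteq> \<Omega> - (T \<union> S)"
      and p: "p \<in> sphere x0 R" "p \<in> T"
      by fastforce
    have pM: "p \<in> \<Omega>" "u p = M" using p by (auto simp: T_def)
    have sub': "ball x0 R \<subseteq> \<Omega> - S" using sub by blast
    have "u x < M" if "x \<in> ball x0 R" for x
      using le_\<Omega>[of x] that sub by (force simp: T_def)
    then obtain D where D: "D > 0" "has_outward_derivative u p ((p - x0) /\<^sub>R R) D"
      using hopf[OF R sub' _ p(1) pM(2)] by blast
    have "u differentiable (at p)"
      using pM \<open>C2_on \<Omega> u\<close> by (simp add: C2_on_def C1_on_def)
    then have "D = 0"
      using outward_derivative_at_interior_max[OF \<open>open \<Omega>\<close> pM(1) _ _ D(2)] le_\<Omega> pM(2) by auto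
    then show False using D by simp
  qed
  then have less: "u x < M" if "x \<in> ball xb' Rb" for x
    using le_\<Omega>[of x] that \<open>ball xb' Rb \<subseteq> \<Omega> - S\<close> by (force simp: T_def)
  have "u xb = M" using assms(13) unfolding M_def by (rule sym)
  from hopf[OF assms(14,15) less assms(16) this] show ?thesis .
qed

end
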